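(* Let $\mathcal{H}_N$, $\mathcal{H}_S$, $\mathcal{H}_T$ be finite-dimensional Hilbert spaces, let $\Phi=\Phi_{NS}$ be a density operator on $\mathcal{H}_N\otimes\mathcal{H}_S$ and $\Psi=\Psi_{NT}$ a density operator on $\mathcal{H}_N\otimes\mathcal{H}_T$. Then $\Phi$ is better than $\Psi$ (in the sense defined in the context) if and only if there exists a completely positive trace-preserving linear map $\mathcal{E}$ from operators on $\mathcal{H}_S$ to operators on $\mathcal{H}_T$ such that \[\Psi_{NT}=(\mathcal{I}_N\otimes\mathcal{E})\Phi_{NS},\] where $\mathcal{I}_N$ is the identity map on operators over $\mathcal{H}_N$.
   Context: An information structure is a triple $(\mathcal{H}_N,\mathcal{H}_S,\Phi_{NS})$ with $\mathcal{H}_N,\mathcal{H}_S$ finite-dimensional Hilbert spaces and $\Phi_{NS}$ a density operator on $\mathcal{H}_N\otimes\mathcal{H}_S$; the observer has access to $S$. A game is a tuple $(\mathcal{H}_A,\mathcal{H}_B,\rho_{AB},M^1,\dots,M^k)$ where $\mathcal{H}_A,\mathcal{H}_B$ are finite-dimensional Hilbert spaces (the environment), $\rho_{AB}$ is a density operator on $\mathcal{H}_A\otimes\mathcal{H}_B$, $k\ge 1$, and each $M^i$ is a Hermitian operator on $\mathcal{H}_N\otimes\mathcal{H}_B$. A strategy is a POVM $(D^1,\dots,D^k)$ on $\mathcal{H}_S\otimes\mathcal{H}_A$, i.e. positive semidefinite operators with $D^1+\dots+D^k=I$. The optimal payoff is \[R(\Phi_{NS};\rho_{AB},M^1,\dots,M^k)=\max_{(D^1,\dots,D^k)}\sum_{i=1}^k\operatorname{tr}\bigl((\Phi_{NS}\otimes\rho_{AB})(M^i_{NB}\otimes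 D^i_{SA})\bigr),\] the maximum over all strategies (tensor factors reordered appropriately). For information structures $\Phi_{NS}$ on $\mathcal{H}_N\otimes\mathcal{H}_S$ and $\Psi_{NT}$ on $\mathcal{H}_N\otimes\mathcal{H}_T$ (same $\mathcal{H}_N$), $\Phi$ is said to be better than $\Psi$ if for every finite-dimensional $\mathcal{H}_A,\mathcal{H}_B$, every density operator $\rho_{AB}$, every $k$ and every Hermitian $M^1,\dots,M^k$ on $\mathcal{H}_N\otimes\mathcal{H}_B$, one has $R(\Phi_{NS};\rho_{AB},M^1,\dots,M^k)\ge R(\Psi_{NT};\rho_{AB},M^1,\dots,M^k)$. *)

theory Defs
  imports Complex_Main "Jordan_Normal_Form.Matrix"
begin

(* Conventions: a d-dimensional Hilbert space is C^d; operators on it are d x d complex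
   matrices.  For spaces X, Y of dimensions dX, dY the tensor product X (x) Y has basis
   index (x,y) |-> x * dY + y. *)

definition mtrace :: "complex mat \<Rightarrow> complex" where
  "mtrace A = (\<Sum>i<dim_row A. A $$ (i, i))"

definition hermitian_op :: "nat \<Rightarrow> complex mat \<Rightarrow> bool" where
  "hermitian_op d A \<longleftrightarrow> A \<in> carrier_mat d d \<and>
     (\<forall>i<d. \<forall>j<d. A $$ (i, j) = cnj (A $$ (j, i)))"

definition psd_op :: "nat \<Rightarrow> complex mat \<Rightarrow> bool" where
  "psd_op d A \<longleftrightarrow> A \<in> carrier_mat d d \<and>
     (\<forall>v :: nat \<Rightarrow> complex.
        Im (\<Sum>i<d. \<Sum>j<d. cnj (v i) * A $$ (i, j) * v j) = 0 \<and>
        Re (\<Sum>i<d. \<Sum>j<d. cnj (v i) * A $$ (i, j) * v j) \<ge> 0)"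

definition density_op :: "nat \<Rightarrow> complex mat \<Rightarrow> bool" where
  "density_op d \<rho> \<longleftrightarrow> psd_op d \<rho> \<and> mtrace \<rho> = 1"

definition is_povm :: "nat \<Rightarrow> nat \<Rightarrow> (nat \<Rightarrow> complex mat) \<Rightarrow> bool" where
  "is_povm d k D \<longleftrightarrow> (\<forall>i<k. psd_op d (D i)) \<and>
     (\<forall>a<d. \<forall>b<d. (\<Sum>i<k. D i $$ (a, b)) = (if a = b then 1 else 0))"

(* sum_i tr((Phi_NS (x) rho_AB)(M^i_NB (x) D^i_SA)), tensor factors reordered to N S A B,
   written out entrywise *)
definition payoff ::
  "nat \<Rightarrow> nat \<Rightarrow> nat \<Rightarrow> nat \<Rightarrow> complex mat \<Rightarrow> complex mat \<Rightarrow> nat \<Rightarrow>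
   (nat \<Rightarrow> complex mat) \<Rightarrow> (nat \<Rightarrow> complex mat) \<Rightarrow> real" where
  "payoff dN dS dA dB \<Phi> \<rho> k M D = Re (\<Sum>i<k.
     \<Sum>n<dN. \<Sum>s<dS. \<Sum>a<dA. \<Sum>b<dB. \<Sum>n'<dN. \<Sum>s'<dS. \<Sum>a'<dA. \<Sum>b'<dB.
       \<Phi> $$ (n * dS + s, n' * dS + s') * \<rho> $$ (a * dB + b, a' * dB + b')
       * M i $$ (n' * dB + b', n * dB + b) * D i $$ (s' * dA + a', s * dA + a))"

definition opt_payoff ::
  "nat \<Rightarrow> nat \<Rightarrow> nat \<Rightarrow> nat \<Rightarrow> complex mat \<Rightarrow> complex mat \<Rightarrow> nat \<Rightarrow>
   (nat \<Rightarrow> complex mat) \<Rightarrow> real" where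
  "opt_payoff dN dS dA dB \<Phi> \<rho> k M =
     Sup {payoff dN dS dA dB \<Phi> \<rho> k M D | D. is_povm (dS * dA) k D}"

definition better ::
  "nat \<Rightarrow> nat \<Rightarrow> nat \<Rightarrow> complex mat \<Rightarrow> complex mat \<Rightarrow> bool" where
  "better dN dS dT \<Phi> \<Psi> \<longleftrightarrow>
     (\<forall>dA dB \<rho> k M. density_op (dA * dB) \<rho> \<and> k \<ge> 1 \<and>
        (\<forall>i<k. hermitian_op (dN * dB) (M i)) \<longrightarrow>
        opt_payoff dN dT dA dB \<Psi> \<rho> k M \<le> opt_payoff dN dS dA dB \<Phi> \<rho> k M)"

(* (I_m (x) E) X for X an operator on C^m (x) C^dS, E : ops on C^dS -> ops on C^dT *)
definition id_tensor ::
  "nat \<Rightarrow> nat \<Rightarrow> nat \<Rightarrow> (complex mat \<Rightarrow> complex mat) \<Rightarrow> complex mat \<Rightarrow> complex mat" where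
  "id_tensor m dS dT E X = mat (m * dT) (m * dT) (\<lambda>(p, q).
     E (mat dS dS (\<lambda>(s, s'). X $$ ((p div dT) * dS + s, (q div dT) * dS + s')))
       $$ (p mod dT, q mod dT))"

definition linear_op_map :: "nat \<Rightarrow> nat \<Rightarrow> (complex mat \<Rightarrow> complex mat) \<Rightarrow> bool" where
  "linear_op_map dS dT E \<longleftrightarrow>
     (\<forall>A \<in> carrier_mat dS dS. E A \<in> carrier_mat dT dT) \<and>
     (\<forall>A \<in> carrier_mat dS dS. \<forall>B \<in> carrier_mat dS dS. E (A + B) = E A + E B) \<and>
     (\<forall>c. \<forall>A \<in> carrier_mat dS dS. E (c \<cdot>\<^sub>m A) = c \<cdot>\<^sub>m E A)"

definition completely_positive :: "nat \<Rightarrow> nat \<Rightarrow> (complex mat \<Rightarrow> complex mat) \<Rightarrow> bool" where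
  "completely_positive dS dT E \<longleftrightarrow>
     (\<forall>m X. psd_op (m * dS) X \<longrightarrow> psd_op (m * dT) (id_tensor m dS dT E X))"

definition trace_preserving :: "nat \<Rightarrow> nat \<Rightarrow> (complex mat \<Rightarrow> complex mat) \<Rightarrow> bool" where
  "trace_preserving dS dT E \<longleftrightarrow> (\<forall>A \<in> carrier_mat dS dS. mtrace (E A) = mtrace A)"

definition cptp :: "nat \<Rightarrow> nat \<Rightarrow> (complex mat \<Rightarrow> complex mat) \<Rightarrow> bool" where
  "cptp dS dT E \<longleftrightarrow> linear_op_map dS dT E \<and> completely_positive dS dT E \<and>
     trace_preserving dS dT E"

end

theory Submission
  imports "HOL-Analysis.Topology_Euclidean_Space" "HOL-Analysis.Function_Topology" Defs
begin

text \<open>If \<open>\<Psi>\<close> arises from \<open>\<Phi>\<close> by a channel, a strategy for \<open>\<Psi>\<close> is turned into one for \<open>\<Phi>\<close> with the same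
  payoff by applying the dual channel to the measurement.

  Conversely, the operators obtained from \<open>\<Phi>\<close> by channels form a compact convex set. Let \<open>G\<close> be the
  difference between \<open>\<Psi>\<close> and its nearest point in this set; it is Hermitian and separates. In the
  game with \<open>\<rho>\<close> maximally entangled and payoffs \<open>U\<^sub>i G U\<^sub>i\<^sup>*\<close>, for the Weyl operators \<open>U\<^sub>i\<close>, the
  holder of \<open>\<Psi>\<close> teleports \<open>T\<close> onto \<open>B\<close> and earns \<open>tr (G \<Psi>)\<close>, whereas every strategy for \<open>\<Phi>\<close>
  implements a channel from \<open>S\<close> to \<open>B\<close> and so earns at most the value of \<open>tr (G _)\<close> at the nearest
  point. If \<open>\<Phi>\<close> is better than \<open>\<Psi>\<close> this forces \<open>G = 0\<close>.\<close>

section \<open>Positive semidefinite kernels\<close>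

text \<open>Indices come from an arbitrary set, so that operators on tensor products can be indexed
  by pairs. In the order on complex numbers, \<open>0 \<le> z\<close> includes that \<open>z\<close>
  is real.\<close>

definition psd_on :: "'a set \<Rightarrow> ('a \<Rightarrow> 'a \<Rightarrow> complex) \<Rightarrow> bool" where
  "psd_on I A \<longleftrightarrow> (\<forall>v. 0 \<le> (\<Sum>i\<in>I. \<Sum>j\<in>I. cnj (v i) * A i j * v j))"

lemma psd_onD: "psd_on I A \<Longrightarrow> 0 \<le> (\<Sum>i\<in>I. \<Sum>j\<in>I. cnj (v i) * A i j * v j)"
  by (simp add: psd_on_def)

lemma cnj_mult_self_nonneg: "0 \<le> cnj z * z"
  by (simp add: less_eq_complex_def)

lemma psd_on_cong:
  assumes "\<And>i j. i \<in> I \<Longrightarrow> j \<in> I \<Longrightarrow> A i j = B i j"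
  shows "psd_on I A \<longleftrightarrow> psd_on I B"
proof -
  have "(\<Sum>i\<in>I. \<Sum>j\<in>I. cnj (v i) * A i j * v j) = (\<Sum>i\<in>I. \<Sum>j\<in>I. cnj (v i) * B i j * v j)" for v
    using assms by (intro sum.cong refl) simp
  then show ?thesis by (simp add: psd_on_def)
qed

lemma psd_on_subset:
  assumes "finite I" "J \<subseteq> I" "psd_on I A"
  shows "psd_on J A"
  unfolding psd_on_def
proof
  fix v :: "'a \<Rightarrow> complex"
  let ?w = "\<lambda>i. if i \<in> J then v i else 0"
  have "(\<Sum>i\<in>J. \<Sum>j\<in>J. cnj (v i) * A i j * v j) = (\<Sum>i\<in>J. \<Sum>j\<in>J. cnj (?w i) * A i j * ?w j)"
    by (intro sum.cong refl) simp
  also have "\<dots> = (\<Sum>i\<in>J. \<Sum>j\<in>I. cnj (?w i) * A i j * ?w j)"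
    using assms by (intro sum.cong refl sum.mono_neutral_left) auto
  also have "\<dots> = (\<Sum>i\<in>I. \<Sum>j\<in>I. cnj (?w i) * A i j * ?w j)"
    using assms by (intro sum.mono_neutral_left) auto
  also have "0 \<le> \<dots>"
    using assms(3) by (rule psd_onD)
  finally show "0 \<le> (\<Sum>i\<in>J. \<Sum>j\<in>J. cnj (v i) * A i j * v j)" .
qed

lemma psd_on_diag:
  assumes "finite I" "psd_on I A" "p \<in> I"
  shows "0 \<le> A p p"
  using psd_onD[OF psd_on_subset[OF assms(1) _ assms(2), of "{p}"], of "\<lambda>_. 1"] assms(3) by simp

lemma psd_on_two_points:
  assumes "finite I" "psd_on I A" "p \<in> I" "q \<in> I" "p \<noteq> q"
  shows "0 \<le> cnj \<alpha> * A p p * \<alpha> + cnj \<alpha> * A p q * \<beta> + cnj \<beta> * A q p * \<alpha> + cnj \<beta> * A q q * \<beta>"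
  using psd_onD[OF psd_on_subset[OF assms(1) _ assms(2), of "{p, q}"], of "\<lambda>i. if i = p then \<alpha> else \<beta>"]
    assms(3-5) by (simp add: add.assoc)

lemma psd_on_hermitian:
  assumes "finite I" "psd_on I A" "p \<in> I" "q \<in> I"
  shows "A q p = cnj (A p q)"
proof (cases "p = q")
  case True
  then show ?thesis
    using psd_on_diag[OF assms(1-3)] by (simp add: complex_eq_iff less_eq_complex_def)
next
  case False
  note two = psd_on_two_points[OF assms False]
  have "Im (A p p) = 0" "Im (A q q) = 0"
    using psd_on_diag[OF assms(1,2)] assms(3,4) by (auto simp: less_eq_complex_def)
  then show ?thesis
    \<comment> \<open>The form is real at (1, 1) and at (1, i); the first value shows that the
      imaginary parts of \<open>A p q\<close> and \<open>A q p\<close> cancel, the second that their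
      real parts agree.\<close>
    using two[of 1 1] two[of 1 \<i>]
    by (simp add: complex_eq_iff less_eq_complex_def)
qed

lemma psd_on_zero_diag:
  assumes "finite I" "psd_on I A" "p \<in> I" "q \<in> I" "A p p = 0"
  shows "A p q = 0"
proof (rule ccontr)
  assume ne: "A p q \<noteq> 0"
  then have "p \<noteq> q" using assms(5) by auto
  \<comment> \<open>With this \<open>c\<close> the form at the vector
    \<open>(- c * A p q, 1)\<close> takes the value \<open>- Re (A q q) - 2\<close>, which is
    negative.\<close>
  define c :: real where "c = (Re (A q q) + 1) / (cmod (A p q))\<^sup>2"
  have "0 \<le> - of_real c * cnj (A p q) * A p q - A q p * (of_real c * A p q) + A q q"
    using psd_on_two_points[OF assms(1-4) \<open>p \<noteq> q\<close>, of "- of_real c * A p q" 1] assms(5) by simp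
  also have "A q p = cnj (A p q)"
    using assms by (intro psd_on_hermitian) auto
  finally have "0 \<le> Re (- of_real c * cnj (A p q) * A p q - cnj (A p q) * (of_real c * A p q) + A q q)"
    by (simp add: less_eq_complex_def)
  also have "\<dots> = - 2 * c * (cmod (A p q))\<^sup>2 + Re (A q q)"
    unfolding cmod_power2 by (simp add: power2_eq_square algebra_simps)
  also have "c * (cmod (A p q))\<^sup>2 = Re (A q q) + 1"
    using ne by (simp add: c_def)
  then have "- 2 * c * (cmod (A p q))\<^sup>2 = - 2 * (Re (A q q) + 1)" by simp
  finally have "Re (A q q) \<le> - 2" by simp
  moreover have "0 \<le> Re (A q q)"
    using psd_on_diag[OF assms(1,2,4)] by (simp add: less_eq_complex_def)
  ultimately show False by simp
qed

text \<open>Schur complement: the pivot \<open>x\<close> is eliminated by the choice of \<open>v x\<close> minimising the form.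
  Since division by zero gives zero, the degenerate case \<open>A x x = 0\<close> needs no separate treatment.\<close>

lemma psd_on_schur_complement:
  assumes "finite F" "x \<notin> F" and A: "psd_on (insert x F) A"
  shows "psd_on F (\<lambda>i j. A i j - A i x * A x j / A x x)"
  unfolding psd_on_def
proof
  fix v :: "'a \<Rightarrow> complex"
  define a where "a = A x x"
  define r where "r = (\<Sum>j\<in>F. A x j * v j)"
  define w where "w = v(x := - r / a)"
  have a: "cnj a = a"
    using psd_on_hermitian[OF _ A, of x x] assms(1) by (simp add: a_def)
  have herm: "A i x = cnj (A x i)" if "i \<in> F" for i
    using psd_on_hermitian[OF _ A, of x i] assms(1) that by simp
  have r': "(\<Sum>i\<in>F. cnj (v i) * A i x) = cnj r"
    unfolding r_def cnj_sum using herm by (intro sum.cong refl) simp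
  \<comment> \<open>A vanishing pivot forces its whole row to vanish, so the cross terms disappear
    along with it.\<close>
  have z: "r = 0" if "a = 0"
    unfolding r_def using psd_on_zero_diag[OF _ A, of x] assms(1) that
    by (intro sum.neutral) (auto simp: a_def)
  have wF: "w i = v i" if "i \<in> F" for i
    using that assms(2) by (auto simp: w_def)
  have "(\<Sum>i\<in>insert x F. \<Sum>j\<in>insert x F. cnj (w i) * A i j * w j)
      = cnj (w x) * a * w x + cnj (w x) * (\<Sum>j\<in>F. A x j * w j)
        + ((\<Sum>i\<in>F. cnj (w i) * A i x) * w x + (\<Sum>i\<in>F. \<Sum>j\<in>F. cnj (w i) * A i j * w j))"
    using assms(1,2)
    by (simp add: a_def sum.distrib sum_distrib_left sum_distrib_right mult.assoc)
  also have "\<dots> = cnj (w x) * a * w x + cnj (w x) * r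
        + (cnj r * w x + (\<Sum>i\<in>F. \<Sum>j\<in>F. cnj (v i) * A i j * v j))"
    using r' by (simp add: r_def wF cong: sum.cong del: cnj_sum)
  also have "\<dots> = (\<Sum>i\<in>F. \<Sum>j\<in>F. cnj (v i) * A i j * v j) - cnj r * r / a"
    using a z by (cases "a = 0") (simp_all add: w_def field_simps)
  also have "cnj r * r / a = (\<Sum>i\<in>F. \<Sum>j\<in>F. cnj (v i) * (A i x * A x j / a) * v j)"
    unfolding r'[symmetric] unfolding r_def sum_product
    by (simp add: sum_divide_distrib algebra_simps)
  finally have "(\<Sum>i\<in>insert x F. \<Sum>j\<in>insert x F. cnj (w i) * A i j * w j)
      = (\<Sum>i\<in>F. \<Sum>j\<in>F. cnj (v i) * (A i j - A i x * A x j / a) * v j)"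
    by (simp add: sum_subtractf algebra_simps)
  then show "0 \<le> (\<Sum>i\<in>F. \<Sum>j\<in>F. cnj (v i) * (A i j - A i x * A x j / A x x) * v j)"
    using psd_onD[OF A, of w] by (simp add: a_def)
qed

text \<open>Cholesky factorisation, one pivot at a time: splitting off the rank-one kernel of the
  scaled pivot column leaves the Schur complement, which lives on the smaller index set. Each pivot
  contributes one vector, hence the summation over \<open>I\<close> itself.\<close>

lemma psd_on_decompose:
  assumes "finite I" "psd_on I A"
  shows "\<exists>W. \<forall>i\<in>I. \<forall>j\<in>I. A i j = (\<Sum>k\<in>I. W k i * cnj (W k j))"
  using assms
proof (induction I arbitrary: A rule: finite_induct)
  case empty
  then show ?case by simp
next
  case (insert x F)
  define s where "s = sqrt (Re (A x x))"
  have fin: "finite (insert x F)" using insert.hyps by simp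
  have "0 \<le> A x x"
    using psd_on_diag[OF fin insert.prems] by simp
  then have s: "of_real s * of_real s = A x x"
    by (simp add: s_def less_eq_complex_def complex_eq_iff flip: power2_eq_square)
  obtain W where W: "\<And>i j. i \<in> F \<Longrightarrow> j \<in> F \<Longrightarrow>
      A i j - A i x * A x j / A x x = (\<Sum>k\<in>F. W k i * cnj (W k j))"
    using insert.IH[OF psd_on_schur_complement[OF insert.hyps insert.prems]] by blast
  \<comment> \<open>The new vector is the pivot column divided by the root of the pivot; the old
    ones are extended by zero at \<open>x\<close>.\<close>
  define V where "V = (\<lambda>k i. if k = x then A i x / of_real s else if i = x then 0 else W k i)"
  have herm: "A j i = cnj (A i j)" if "i \<in> insert x F" "j \<in> insert x F" for i j
    using psd_on_hermitian[OF fin insert.prems that] .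
  have zero: "A x i = 0" "A i x = 0" if "A x x = 0" "i \<in> insert x F" for i
    using psd_on_zero_diag[OF fin insert.prems insertI1 that(2,1)] herm[of x i] that(2) by auto
  have piv: "V x i * cnj (V x j) = A i x * A x j / A x x"
    if "i \<in> insert x F" "j \<in> insert x F" for i j
    using herm[of x j] that by (simp add: V_def s flip: s)
  have "A i j = (\<Sum>k\<in>insert x F. V k i * cnj (V k j))"
    if i: "i \<in> insert x F" and j: "j \<in> insert x F" for i j
  proof -
    have "(\<Sum>k\<in>insert x F. V k i * cnj (V k j))
        = A i x * A x j / A x x + (\<Sum>k\<in>F. V k i * cnj (V k j))"
      using insert.hyps piv[OF i j] by simp
    also have "\<dots> = A i j"
    proof (cases "i = x \<or> j = x")
      case True
      then have "(\<Sum>k\<in>F. V k i * cnj (V k j)) = 0"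
        using insert.hyps by (intro sum.neutral) (auto simp: V_def)
      then show ?thesis using True zero[of i] zero[of j] i j by (cases "A x x = 0") auto
    next
      case False
      then have "(\<Sum>k\<in>F. V k i * cnj (V k j)) = (\<Sum>k\<in>F. W k i * cnj (W k j))"
        using insert.hyps by (intro sum.cong refl) (auto simp: V_def)
      also have "\<dots> = A i j - A i x * A x j / A x x"
        using W[of i j] False i j by auto
      finally show ?thesis by simp
    qed
    finally show ?thesis by simp
  qed
  then show ?case by blast
qed

lemma psd_on_rank_one: "psd_on I (\<lambda>i j. w i * cnj (w j))"
  unfolding psd_on_def
proof
  fix v :: "'a \<Rightarrow> complex"
  have "(\<Sum>i\<in>I. \<Sum>j\<in>I. cnj (v i) * (w i * cnj (w j)) * v j)
      = cnj (\<Sum>i\<in>I. cnj (w i) * v i) * (\<Sum>j\<in>I. cnj (w j) * v j)"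
    unfolding cnj_sum sum_product by (simp add: mult_ac)
  then show "0 \<le> (\<Sum>i\<in>I. \<Sum>j\<in>I. cnj (v i) * (w i * cnj (w j)) * v j)"
    by (simp only: cnj_mult_self_nonneg)
qed

text \<open>By the factorisation, \<open>A p q\<close> is an inner product of two vectors whose
  squared norms are the diagonal entries. Applied to channel kernels and to measurements, this
  bounds all entries through the diagonal.\<close>

lemma psd_on_norm_le:
  assumes "finite I" "psd_on I A" "p \<in> I" "q \<in> I"
  shows "cmod (A p q) \<le> (Re (A p p) + Re (A q q)) / 2"
proof -
  obtain W where W: "\<And>i j. i \<in> I \<Longrightarrow> j \<in> I \<Longrightarrow> A i j = (\<Sum>k\<in>I. W k i * cnj (W k j))"
    using psd_on_decompose[OF assms(1,2)] by blast
  have "cmod (A p q) \<le> (\<Sum>k\<in>I. cmod (W k p) * cmod (W k q))"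
    unfolding W[OF assms(3,4)]
    by (rule order_trans[OF norm_sum]) (simp add: norm_mult)
  also have "\<dots> \<le> (\<Sum>k\<in>I. ((cmod (W k p))\<^sup>2 + (cmod (W k q))\<^sup>2) / 2)"
  proof (rule sum_mono)
    fix k
    show "cmod (W k p) * cmod (W k q) \<le> ((cmod (W k p))\<^sup>2 + (cmod (W k q))\<^sup>2) / 2"
      using sum_squares_bound[of "cmod (W k p)" "cmod (W k q)"] by simp
  qed
  also have "\<dots> = (Re (A p p) + Re (A q q)) / 2"
    unfolding W[OF assms(3,3)] W[OF assms(4,4)]
    unfolding cmod_power2
    by (simp add: sum.distrib add_divide_distrib sum_divide_distrib power2_eq_square)
  finally show ?thesis .
qed

section \<open>Closure properties of positive semidefinite kernels\<close>

lemma psd_on_add: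
  assumes "psd_on I A" "psd_on I B"
  shows "psd_on I (\<lambda>i j. A i j + B i j)"
  unfolding psd_on_def
proof
  fix v :: "'a \<Rightarrow> complex"
  have "(\<Sum>i\<in>I. \<Sum>j\<in>I. cnj (v i) * (A i j + B i j) * v j)
    = (\<Sum>i\<in>I. \<Sum>j\<in>I. cnj (v i) * A i j * v j) + (\<Sum>i\<in>I. \<Sum>j\<in>I. cnj (v i) * B i j * v j)"
    by (simp add: algebra_simps sum.distrib)
  then show "0 \<le> (\<Sum>i\<in>I. \<Sum>j\<in>I. cnj (v i) * (A i j + B i j) * v j)"
    using psd_onD[OF assms(1), of v] psd_onD[OF assms(2), of v] by simp
qed

lemma psd_on_zero: "psd_on I (\<lambda>i j. 0)"
  by (simp add: psd_on_def)

lemma psd_on_sum: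
  assumes "\<And>k. k \<in> X \<Longrightarrow> psd_on I (A k)"
  shows "psd_on I (\<lambda>i j. \<Sum>k\<in>X. A k i j)"
  using assms
  by (induction X rule: infinite_finite_induct) (auto simp: psd_on_zero intro: psd_on_add)

lemma psd_on_scale:
  assumes "psd_on I A" "0 \<le> c"
  shows "psd_on I (\<lambda>i j. of_real c * A i j)"
  unfolding psd_on_def
proof
  fix v :: "'a \<Rightarrow> complex"
  have "(\<Sum>i\<in>I. \<Sum>j\<in>I. cnj (v i) * (of_real c * A i j) * v j)
    = of_real c * (\<Sum>i\<in>I. \<Sum>j\<in>I. cnj (v i) * A i j * v j)"
    by (simp add: sum_distrib_left algebra_simps)
  then show "0 \<le> (\<Sum>i\<in>I. \<Sum>j\<in>I. cnj (v i) * (of_real c * A i j) * v j)"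
    using psd_onD[OF assms(1), of v] assms(2) by (simp add: less_eq_complex_def)
qed

text \<open>Testing the adjoint of \<open>L\<close> times \<open>A\<close> times \<open>L\<close> on
  \<open>v\<close> amounts to testing \<open>A\<close> on \<open>L v\<close>.\<close>

lemma psd_on_congruence:
  assumes "psd_on I A"
  shows "psd_on J (\<lambda>p q. \<Sum>i\<in>I. \<Sum>j\<in>I. cnj (L i p) * A i j * L j q)"
  unfolding psd_on_def
proof
  fix v :: "'b \<Rightarrow> complex"
  have "(\<Sum>p\<in>J. \<Sum>q\<in>J. cnj (v p) * (\<Sum>i\<in>I. \<Sum>j\<in>I. cnj (L i p) * A i j * L j q) * v q)
      = (\<Sum>p\<in>J. \<Sum>q\<in>J. \<Sum>i\<in>I. \<Sum>j\<in>I. cnj (v p) * cnj (L i p) * A i j * L j q * v q)"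
    by (simp add: sum_distrib_left sum_distrib_right mult.assoc)
  also have "\<dots> = (\<Sum>i\<in>I. \<Sum>j\<in>I. \<Sum>p\<in>J. \<Sum>q\<in>J. cnj (v p) * cnj (L i p) * A i j * L j q * v q)"
    unfolding sum.cartesian_product
    by (rule sum.reindex_bij_witness[where i = "\<lambda>(i, j, p, q). (p, q, i, j)" and j = "\<lambda>(p, q, i, j). (i, j, p, q)"])
      auto
  also have "\<dots> = (\<Sum>i\<in>I. \<Sum>j\<in>I. cnj (\<Sum>p\<in>J. L i p * v p) * A i j * (\<Sum>q\<in>J. L j q * v q))"
    by (simp add: sum_distrib_left sum_distrib_right mult_ac)
  also have "0 \<le> \<dots>"
    using assms by (rule psd_onD)
  finally show "0 \<le> (\<Sum>p\<in>J. \<Sum>q\<in>J. cnj (v p) * (\<Sum>i\<in>I. \<Sum>j\<in>I. cnj (L i p) * A i j * L j q) * v q)" .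
qed

lemma psd_on_transpose:
  assumes "psd_on I A"
  shows "psd_on I (\<lambda>i j. A j i)"
  unfolding psd_on_def
proof
  fix v :: "'a \<Rightarrow> complex"
  have "(\<Sum>i\<in>I. \<Sum>j\<in>I. cnj (v i) * A j i * v j) = (\<Sum>j\<in>I. \<Sum>i\<in>I. cnj (cnj (v j)) * A j i * cnj (v i))"
    by (subst sum.swap) (simp add: mult_ac)
  then show "0 \<le> (\<Sum>i\<in>I. \<Sum>j\<in>I. cnj (v i) * A j i * v j)"
    using psd_onD[OF assms, of "\<lambda>i. cnj (v i)"] by simp
qed

lemma psd_on_reindex:
  assumes "psd_on I A" "bij_betw f J I"
  shows "psd_on J (\<lambda>p q. A (f p) (f q))"
  unfolding psd_on_def
proof
  fix v :: "'b \<Rightarrow> complex"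
  define w where "w = (\<lambda>i. v (the_inv_into J f i))"
  have w: "w (f p) = v p" if "p \<in> J" for p
    using that assms(2) by (simp add: w_def the_inv_into_f_f bij_betw_def)
  have "(\<Sum>p\<in>J. \<Sum>q\<in>J. cnj (v p) * A (f p) (f q) * v q)
      = (\<Sum>p\<in>J. \<Sum>q\<in>J. cnj (w (f p)) * A (f p) (f q) * w (f q))"
    by (simp add: w cong: sum.cong)
  also have "\<dots> = (\<Sum>p\<in>J. \<Sum>j\<in>I. cnj (w (f p)) * A (f p) j * w j)"
    by (intro sum.cong refl sum.reindex_bij_betw[OF assms(2), where g = "\<lambda>j. cnj (w (f _)) * A (f _) j * w j"])
  also have "\<dots> = (\<Sum>i\<in>I. \<Sum>j\<in>I. cnj (w i) * A i j * w j)"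
    by (rule sum.reindex_bij_betw[OF assms(2), where g = "\<lambda>i. \<Sum>j\<in>I. cnj (w i) * A i j * w j"])
  finally show "0 \<le> (\<Sum>p\<in>J. \<Sum>q\<in>J. cnj (v p) * A (f p) (f q) * v q)"
    using psd_onD[OF assms(1), of w] by simp
qed

text \<open>Up to transposition on \<open>T\<close>, \<open>contract S A K\<close> is the partial trace over \<open>S\<close> of the product of
  \<open>A\<close> on \<open>N \<otimes> S\<close> and \<open>K\<close> on \<open>S \<otimes> T\<close>. It is the action on the second factor of \<open>A\<close> of the
  channel whose Choi matrix is the transpose of \<open>K\<close>.\<close>

definition contract :: "'s set \<Rightarrow> ('n \<times> 's \<Rightarrow> 'n \<times> 's \<Rightarrow> complex) \<Rightarrow> ('s \<times> 't \<Rightarrow> 's \<times> 't \<Rightarrow> complex)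
    \<Rightarrow> 'n \<times> 't \<Rightarrow> 'n \<times> 't \<Rightarrow> complex" where
  "contract S A K = (\<lambda>(n, t) (n', t'). \<Sum>s\<in>S. \<Sum>s'\<in>S. A (n, s) (n', s') * K (s', t') (s, t))"

lemma contract_apply [simp]:
  "contract S A K (n, t) (n', t') = (\<Sum>s\<in>S. \<Sum>s'\<in>S. A (n, s) (n', s') * K (s', t') (s, t))"
  by (simp add: contract_def)

text \<open>A factorisation of \<open>K\<close> supplies Kraus operators: each vector
  \<open>W k\<close>, read as a matrix from \<open>T\<close> to \<open>S\<close> and tensored with
  the identity on \<open>N\<close>, is the \<open>L k\<close> of the proof, and the contraction is
  the sum of the congruences of \<open>A\<close> by the \<open>L k\<close>.\<close>

lemma psd_on_contract:
  assumes fin: "finite N" "finite S" "finite T"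
    and A: "psd_on (N \<times> S) A" and K: "psd_on (S \<times> T) K"
  shows "psd_on (N \<times> T) (contract S A K)"
proof -
  obtain W where W: "\<And>i j. i \<in> S \<times> T \<Longrightarrow> j \<in> S \<times> T \<Longrightarrow>
      K i j = (\<Sum>k\<in>S \<times> T. W k i * cnj (W k j))"
    using psd_on_decompose[OF _ K] fin by blast
  define L where "L = (\<lambda>k (n :: 'a, s) (m, t :: 'c). if n = m then W k (s, t) else 0)"
  have "psd_on (N \<times> T) (\<lambda>p q. \<Sum>k\<in>S \<times> T. \<Sum>i\<in>N \<times> S. \<Sum>j\<in>N \<times> S. cnj (L k i p) * A i j * L k j q)"
    by (intro psd_on_sum psd_on_congruence A)
  also have "?this \<longleftrightarrow> ?thesis"
  proof (rule psd_on_cong, clarify)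
    fix n t n' t'
    assume m: "n \<in> N" "t \<in> T" "n' \<in> N" "t' \<in> T"
    have "(\<Sum>i\<in>N \<times> S. \<Sum>j\<in>N \<times> S. cnj (L k i (n, t)) * A i j * L k j (n', t'))
        = (\<Sum>s\<in>S. \<Sum>s'\<in>S. cnj (W k (s, t)) * A (n, s) (n', s') * W k (s', t'))" for k
    proof -
      have "(\<Sum>i\<in>N \<times> S. \<Sum>j\<in>N \<times> S. cnj (L k i (n, t)) * A i j * L k j (n', t'))
          = (\<Sum>i\<in>{n} \<times> S. \<Sum>j\<in>N \<times> S. cnj (L k i (n, t)) * A i j * L k j (n', t'))"
        using fin m by (intro sum.mono_neutral_right) (auto simp: L_def intro!: sum.neutral split: if_splits)
      also have "\<dots> = (\<Sum>i\<in>{n} \<times> S. \<Sum>j\<in>{n'} \<times> S. cnj (L k i (n, t)) * A i j * L k j (n', t'))"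
        using fin m by (intro sum.cong[OF refl], intro sum.mono_neutral_right) (auto simp: L_def split: if_splits)
      also have "\<dots> = (\<Sum>s\<in>S. \<Sum>s'\<in>S. cnj (W k (s, t)) * A (n, s) (n', s') * W k (s', t'))"
        by (simp add: sum.cartesian_product' L_def)
      finally show ?thesis .
    qed
    then have "(\<Sum>k\<in>S \<times> T. \<Sum>i\<in>N \<times> S. \<Sum>j\<in>N \<times> S. cnj (L k i (n, t)) * A i j * L k j (n', t'))
        = (\<Sum>k\<in>S \<times> T. \<Sum>s\<in>S. \<Sum>s'\<in>S. cnj (W k (s, t)) * A (n, s) (n', s') * W k (s', t'))"
      by simp
    also have "\<dots> = (\<Sum>s\<in>S. \<Sum>s'\<in>S. \<Sum>k\<in>S \<times> T. cnj (W k (s, t)) * A (n, s) (n', s') * W k (s', t'))"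
      by (subst sum.swap, intro sum.cong refl, subst sum.swap) simp
    also have "\<dots> = contract S A K (n, t) (n', t')"
      using m by (simp add: W sum_distrib_left mult_ac cong: sum.cong)
    finally show "(\<Sum>k\<in>S \<times> T. \<Sum>i\<in>N \<times> S. \<Sum>j\<in>N \<times> S. cnj (L k i (n, t)) * A i j * L k j (n', t'))
        = contract S A K (n, t) (n', t')" .
  qed
  finally show ?thesis .
qed

section \<open>Operators on tensor products\<close>

definition tensor_entry :: "nat \<Rightarrow> complex mat \<Rightarrow> nat \<times> nat \<Rightarrow> nat \<times> nat \<Rightarrow> complex" where
  "tensor_entry d A = (\<lambda>(x, y) (x', y'). A $$ (x * d + y, x' * d + y'))"

lemma tensor_entry_apply [simp]:
  "tensor_entry d A (x, y) (x', y') = A $$ (x * d + y, x' * d + y')"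
  by (simp add: tensor_entry_def)

lemma tensor_index_less:
  assumes "x < m" "y < (d :: nat)"
  shows "x * d + y < m * d"
proof -
  have "x * d + y < (x + 1) * d" using assms(2) by simp
  also have "\<dots> \<le> m * d" using assms(1) by (intro mult_right_mono) auto
  finally show ?thesis .
qed

lemma bij_betw_tensor_index:
  "bij_betw (\<lambda>(x, y). x * d + y) ({..<m} \<times> {..<d}) {..<m * (d :: nat)}"
  by (rule bij_betw_byWitness[where f' = "\<lambda>p. (p div d, p mod d)"])
    (auto simp: tensor_index_less less_mult_imp_div_less intro!: mod_less_divisor gr0I)

lemma sum_tensor_index:
  fixes d :: nat
  shows "(\<Sum>p<m * d. f p) = (\<Sum>x<m. \<Sum>y<d. f (x * d + y))"
  using sum.reindex_bij_betw[OF bij_betw_tensor_index, of f d m]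
  by (simp add: sum.cartesian_product split_beta)

lemma psd_op_iff: "psd_op d A \<longleftrightarrow> A \<in> carrier_mat d d \<and> psd_on {..<d} (\<lambda>i j. A $$ (i, j))"
  by (auto simp: psd_op_def psd_on_def less_eq_complex_def)

lemma psd_op_tensor_iff:
  "psd_op (m * d) A \<longleftrightarrow> A \<in> carrier_mat (m * d) (m * d) \<and> psd_on ({..<m} \<times> {..<d}) (tensor_entry d A)"
proof -
  let ?f = "\<lambda>(x, y). x * d + y" and ?g = "the_inv_into ({..<m} \<times> {..<d}) (\<lambda>(x, y). x * d + y)"
  have g: "bij_betw ?g {..<m * d} ({..<m} \<times> {..<d})"
    by (rule bij_betw_the_inv_into[OF bij_betw_tensor_index])
  have fg: "?f (?g p) = p" if "p < m * d" for p
    using f_the_inv_into_f_bij_betw[OF bij_betw_tensor_index, of d m p] that by simp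
  have te: "tensor_entry d A = (\<lambda>p q. A $$ (?f p, ?f q))"
    by (auto simp: fun_eq_iff)
  have "psd_on {..<m * d} (\<lambda>i j. A $$ (i, j)) \<longleftrightarrow> psd_on ({..<m} \<times> {..<d}) (tensor_entry d A)"
  proof
    assume "psd_on {..<m * d} (\<lambda>i j. A $$ (i, j))"
    from psd_on_reindex[OF this bij_betw_tensor_index]
    show "psd_on ({..<m} \<times> {..<d}) (tensor_entry d A)" by (simp only: te)
  next
    assume "psd_on ({..<m} \<times> {..<d}) (tensor_entry d A)"
    from psd_on_reindex[OF this g]
    have "psd_on {..<m * d} (\<lambda>p q. A $$ (?f (?g p), ?f (?g q)))" by (simp only: te)
    also have "?this \<longleftrightarrow> psd_on {..<m * d} (\<lambda>i j. A $$ (i, j))"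
      by (rule psd_on_cong) (simp only: fg lessThan_iff)
    finally show "psd_on {..<m * d} (\<lambda>i j. A $$ (i, j))" .
  qed
  then show ?thesis by (simp add: psd_op_iff)
qed

definition tensor_mat :: "nat \<Rightarrow> nat \<Rightarrow> (nat \<times> nat \<Rightarrow> nat \<times> nat \<Rightarrow> complex) \<Rightarrow> complex mat" where
  "tensor_mat m d f = mat (m * d) (m * d) (\<lambda>(p, q). f (p div d, p mod d) (q div d, q mod d))"

lemma tensor_mat_carrier [simp]: "tensor_mat m d f \<in> carrier_mat (m * d) (m * d)"
  by (simp add: tensor_mat_def)

lemma tensor_mat_index [simp]:
  assumes "x < m" "y < d" "x' < m" "y' < d"
  shows "tensor_mat m d f $$ (x * d + y, x' * d + y') = f (x, y) (x', y')"
  using assms by (simp add: tensor_mat_def tensor_index_less)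

lemma psd_op_tensor_mat_iff: "psd_op (m * d) (tensor_mat m d f) \<longleftrightarrow> psd_on ({..<m} \<times> {..<d}) f"
  unfolding psd_op_tensor_iff by (auto intro!: psd_on_cong)

lemma mat_eq_tensorI:
  assumes "A \<in> carrier_mat (m * d) (m * d)" "B \<in> carrier_mat (m * d) (m * d)"
    and eq: "\<And>x y x' y'. x < m \<Longrightarrow> y < d \<Longrightarrow> x' < m \<Longrightarrow> y' < d \<Longrightarrow>
      A $$ (x * d + y, x' * d + y') = B $$ (x * d + y, x' * d + y')"
  shows "A = B"
proof (rule eq_matI)
  fix p q assume "p < dim_row B" "q < dim_col B"
  then have *: "p < m * d" "q < m * d" using assms(2) by auto
  then have "0 < d" by (auto intro: gr0I)
  with * show "A $$ (p, q) = B $$ (p, q)"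
    using eq[of "p div d" "p mod d" "q div d" "q mod d"] by (simp add: less_mult_imp_div_less)
qed (use assms in auto)

section \<open>Choi kernels of channels\<close>

text \<open>The second condition says that the partial trace over \<open>T\<close> is the identity
  on \<open>S\<close>, which is trace preservation expressed in the Choi matrix.\<close>

definition channel_kernel :: "'s set \<Rightarrow> 't set \<Rightarrow> ('s \<times> 't \<Rightarrow> 's \<times> 't \<Rightarrow> complex) \<Rightarrow> bool" where
  "channel_kernel S T K \<longleftrightarrow> psd_on (S \<times> T) K \<and>
     (\<forall>s\<in>S. \<forall>s'\<in>S. (\<Sum>t\<in>T. K (s, t) (s', t)) = (if s = s' then 1 else 0))"

text \<open>\<open>K\<close> is the transposed Choi matrix. In this form a channel meets a state
  with the same index pattern as a measurement operator does in \<open>payoff\<close>, so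
  \<open>contract\<close> serves for both.\<close>

definition represents :: "nat \<Rightarrow> nat \<Rightarrow> (complex mat \<Rightarrow> complex mat) \<Rightarrow> (nat \<times> nat \<Rightarrow> nat \<times> nat \<Rightarrow> complex) \<Rightarrow> bool" where
  "represents dS dT E K \<longleftrightarrow> (\<forall>X\<in>carrier_mat dS dS. \<forall>t<dT. \<forall>t'<dT.
     E X $$ (t, t') = (\<Sum>s<dS. \<Sum>s'<dS. X $$ (s, s') * K (s', t') (s, t)))"

lemma id_tensor_carrier [simp]: "id_tensor m dS dT E X \<in> carrier_mat (m * dT) (m * dT)"
  by (simp add: id_tensor_def)

lemma id_tensor_index:
  assumes "n < m" "t < dT" "n' < m" "t' < dT"
  shows "id_tensor m dS dT E X $$ (n * dT + t, n' * dT + t')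
    = E (mat dS dS (\<lambda>(s, s'). X $$ (n * dS + s, n' * dS + s'))) $$ (t, t')"
  using assms by (simp add: id_tensor_def tensor_index_less)

lemma id_tensor_eq_contract:
  assumes "represents dS dT E K" "n < m" "t < dT" "n' < m" "t' < dT"
  shows "id_tensor m dS dT E X $$ (n * dT + t, n' * dT + t')
    = contract {..<dS} (tensor_entry dS X) K (n, t) (n', t')"
  using assms by (simp add: id_tensor_index represents_def)

lemma linear_op_map_expand:
  assumes E: "linear_op_map dS dT E" and X: "X \<in> carrier_mat dS dS" and t: "t < dT" "t' < dT"
  shows "E X $$ (t, t') = (\<Sum>s<dS. \<Sum>s'<dS. X $$ (s, s') *
    E (mat dS dS (\<lambda>(i, j). if i = s \<and> j = s' then 1 else 0)) $$ (t, t'))"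
proof -
  define e :: "nat \<times> nat \<Rightarrow> complex mat" where
    "e = (\<lambda>(s, s'). mat dS dS (\<lambda>(i, j). if i = s \<and> j = s' then 1 else 0))"
  \<comment> \<open>\<open>R F\<close> keeps only the entries of \<open>X\<close> at positions in
    \<open>F\<close>; adding one position at a time turns additivity and homogeneity into the finite
    sum.\<close>
  define R where "R = (\<lambda>F. mat dS dS (\<lambda>p. if p \<in> F then X $$ p else 0))"
  have dim: "E A \<in> carrier_mat dT dT" if "A \<in> carrier_mat dS dS" for A
    using E that by (simp add: linear_op_map_def)
  have car [simp]: "e p \<in> carrier_mat dS dS" "R F \<in> carrier_mat dS dS" for p F
    by (auto simp: e_def R_def split_beta)
  have "E (R F) $$ (t, t') = (\<Sum>p\<in>F. X $$ p * E (e p) $$ (t, t'))" if "finite F" for F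
    using that
  proof (induction F)
    case empty
    \<comment> \<open>The zero matrix is a zero multiple of itself, so homogeneity gives that its
      image vanishes.\<close>
    have "R {} = 0 \<cdot>\<^sub>m R {}" by (rule eq_matI) (auto simp: R_def)
    then have "E (R {}) = 0 \<cdot>\<^sub>m E (R {})"
      using E unfolding linear_op_map_def by (metis car(2))
    then have "E (R {}) $$ (t, t') = (0 \<cdot>\<^sub>m E (R {})) $$ (t, t')" by simp
    also have "\<dots> = 0" using dim[of "R {}"] t by simp
    finally show ?case by simp
  next
    case (insert p F)
    have "R (insert p F) = X $$ p \<cdot>\<^sub>m e p + R F"
      using insert.hyps by (intro eq_matI) (auto simp: R_def e_def split_beta)
    then have "E (R (insert p F)) = X $$ p \<cdot>\<^sub>m E (e p) + E (R F)"
      using E by (simp add: linear_op_map_def)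
    then show ?case
      using insert dim[of "e p"] dim[of "R F"] t by simp
  qed
  from this[of "{..<dS} \<times> {..<dS}"]
  have "E (R ({..<dS} \<times> {..<dS})) $$ (t, t') = (\<Sum>s<dS. \<Sum>s'<dS. X $$ (s, s') * E (e (s, s')) $$ (t, t'))"
    by (simp add: sum.cartesian_product split_beta)
  moreover have "R ({..<dS} \<times> {..<dS}) = X"
    using X by (intro eq_matI) (auto simp: R_def)
  ultimately show ?thesis by (simp add: e_def)
qed

lemma cptp_imp_kernel:
  assumes "cptp dS dT E"
  obtains K where "channel_kernel {..<dS} {..<dT} K" "represents dS dT E K"
proof
  define e :: "nat \<Rightarrow> nat \<Rightarrow> complex mat" where
    "e = (\<lambda>s s'. mat dS dS (\<lambda>(i, j). if i = s \<and> j = s' then 1 else 0))"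
  define K where "K = (\<lambda>(s', t') (s, t). E (e s s') $$ (t, t'))"
  have lin: "linear_op_map dS dT E" and cp: "completely_positive dS dT E"
    and tp: "trace_preserving dS dT E"
    using assms by (auto simp: cptp_def)
  have e: "e s s' \<in> carrier_mat dS dS" for s s' by (simp add: e_def)
  show "represents dS dT E K"
    unfolding represents_def using linear_op_map_expand[OF lin] by (simp add: K_def e_def)
  \<comment> \<open>The Choi matrix is the image of the unnormalised maximally entangled state.\<close>
  define w :: "nat \<times> nat \<Rightarrow> complex" where "w = (\<lambda>(s, r). if s = r then 1 else 0)"
  define \<Omega> where "\<Omega> = tensor_mat dS dS (\<lambda>p q. w p * cnj (w q))"
  have "psd_op (dS * dS) \<Omega>"
    by (simp add: \<Omega>_def psd_op_tensor_mat_iff psd_on_rank_one)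
  then have "psd_op (dS * dT) (id_tensor dS dS dT E \<Omega>)"
    using cp by (simp add: completely_positive_def)
  then have "psd_on ({..<dS} \<times> {..<dT}) (tensor_entry dT (id_tensor dS dS dT E \<Omega>))"
    by (simp add: psd_op_tensor_iff)
  also have "?this \<longleftrightarrow> psd_on ({..<dS} \<times> {..<dT}) (\<lambda>p q. K q p)"
  proof (rule psd_on_cong, clarify)
    fix s t s' t' assume m: "s < dS" "t < dT" "s' < dS" "t' < dT"
    then have "mat dS dS (\<lambda>(r, r'). \<Omega> $$ (s * dS + r, s' * dS + r')) = e s s'"
      by (intro eq_matI) (auto simp: \<Omega>_def w_def e_def)
    then show "tensor_entry dT (id_tensor dS dS dT E \<Omega>) (s, t) (s', t') = K (s', t') (s, t)"
      using m by (simp add: id_tensor_index K_def)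
  qed
  finally have psd: "psd_on ({..<dS} \<times> {..<dT}) K"
    using psd_on_transpose by fastforce
  have "(\<Sum>t<dT. K (s', t) (s, t)) = (if s' = s then 1 else 0)" if "s < dS" "s' < dS" for s s'
  proof -
    have "dim_row (E (e s s')) = dT"
      using lin e[of s s'] unfolding linear_op_map_def by (metis carrier_matD(1))
    then have "(\<Sum>t<dT. K (s', t) (s, t)) = mtrace (E (e s s'))"
      by (simp add: K_def mtrace_def)
    also have "\<dots> = mtrace (e s s')"
      using tp e by (simp add: trace_preserving_def)
    also have "\<dots> = (\<Sum>i<dS. if i = s then if s = s' then 1 else 0 else 0)"
      unfolding mtrace_def by (intro sum.cong) (auto simp: e_def)
    also have "\<dots> = (if s' = s then 1 else 0)" using that by simp
    finally show ?thesis .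
  qed
  with psd show "channel_kernel {..<dS} {..<dT} K"
    by (simp add: channel_kernel_def)
qed

text \<open>The converse half of Choi's theorem: complete positivity is
  \<open>psd_on_contract\<close> for every ancilla dimension, and the trace is preserved because the
  partial trace of \<open>K\<close> is the identity.\<close>

lemma kernel_imp_cptp:
  assumes K: "channel_kernel {..<dS} {..<dT} K"
  obtains E where "cptp dS dT E" "represents dS dT E K"
proof
  define E where "E = (\<lambda>X. mat dT dT (\<lambda>(t, t'). \<Sum>s<dS. \<Sum>s'<dS. X $$ (s, s') * K (s', t') (s, t)))"
  show rep: "represents dS dT E K"
    by (simp add: represents_def E_def)
  have "linear_op_map dS dT E"
    unfolding linear_op_map_def
    by (auto simp: E_def sum.distrib algebra_simps sum_distrib_left)
  moreover have "completely_positive dS dT E"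
    unfolding completely_positive_def
  proof (intro allI impI)
    fix m X assume "psd_op (m * dS) X"
    then have "psd_on ({..<m} \<times> {..<dT}) (contract {..<dS} (tensor_entry dS X) K)"
      using K by (intro psd_on_contract) (auto simp: channel_kernel_def psd_op_tensor_iff)
    also have "?this \<longleftrightarrow> psd_on ({..<m} \<times> {..<dT}) (tensor_entry dT (id_tensor m dS dT E X))"
      by (rule psd_on_cong) (auto simp: id_tensor_eq_contract[OF rep])
    finally show "psd_op (m * dT) (id_tensor m dS dT E X)"
      by (simp add: psd_op_tensor_iff)
  qed
  moreover have "trace_preserving dS dT E"
    unfolding trace_preserving_def
  proof
    fix X :: "complex mat" assume X: "X \<in> carrier_mat dS dS"
    have "mtrace (E X) = (\<Sum>t<dT. \<Sum>s<dS. \<Sum>s'<dS. X $$ (s, s') * K (s', t) (s, t))"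
      by (simp add: mtrace_def E_def)
    also have "\<dots> = (\<Sum>s<dS. \<Sum>s'<dS. \<Sum>t<dT. X $$ (s, s') * K (s', t) (s, t))"
      by (subst sum.swap, rule sum.cong[OF refl], rule sum.swap)
    also have "\<dots> = (\<Sum>s<dS. \<Sum>s'<dS. X $$ (s, s') * (if s' = s then 1 else 0))"
      using K by (simp add: channel_kernel_def flip: sum_distrib_left)
    also have "\<dots> = mtrace X"
      using X by (simp add: mtrace_def if_distrib cong: if_cong)
    finally show "mtrace (E X) = mtrace X" .
  qed
  ultimately show "cptp dS dT E" by (simp add: cptp_def)
qed

text \<open>Trades maps on matrices for kernels, for which compactness and convexity can be argued
  entrywise.\<close>

lemma ex_cptp_iff_ex_kernel:
  assumes "\<Psi> \<in> carrier_mat (dN * dT) (dN * dT)"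
  shows "(\<exists>E. cptp dS dT E \<and> \<Psi> = id_tensor dN dS dT E \<Phi>) \<longleftrightarrow>
    (\<exists>K. channel_kernel {..<dS} {..<dT} K \<and>
      (\<forall>p\<in>{..<dN} \<times> {..<dT}. \<forall>q\<in>{..<dN} \<times> {..<dT}.
        tensor_entry dT \<Psi> p q = contract {..<dS} (tensor_entry dS \<Phi>) K p q))"
proof
  assume "\<exists>E. cptp dS dT E \<and> \<Psi> = id_tensor dN dS dT E \<Phi>"
  then obtain E where E: "cptp dS dT E" "\<Psi> = id_tensor dN dS dT E \<Phi>" by blast
  obtain K where K: "channel_kernel {..<dS} {..<dT} K" "represents dS dT E K"
    using cptp_imp_kernel[OF E(1)] by blast
  then show "\<exists>K. channel_kernel {..<dS} {..<dT} K \<and>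
      (\<forall>p\<in>{..<dN} \<times> {..<dT}. \<forall>q\<in>{..<dN} \<times> {..<dT}.
        tensor_entry dT \<Psi> p q = contract {..<dS} (tensor_entry dS \<Phi>) K p q)"
    by (intro exI[of _ K]) (auto simp: E(2) id_tensor_eq_contract[OF K(2)])
next
  assume "\<exists>K. channel_kernel {..<dS} {..<dT} K \<and>
      (\<forall>p\<in>{..<dN} \<times> {..<dT}. \<forall>q\<in>{..<dN} \<times> {..<dT}.
        tensor_entry dT \<Psi> p q = contract {..<dS} (tensor_entry dS \<Phi>) K p q)"
  then obtain K where K: "channel_kernel {..<dS} {..<dT} K"
    and eq: "\<forall>p\<in>{..<dN} \<times> {..<dT}. \<forall>q\<in>{..<dN} \<times> {..<dT}.
        tensor_entry dT \<Psi> p q = contract {..<dS} (tensor_entry dS \<Phi>) K p q"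
    by blast
  obtain E where E: "cptp dS dT E" "represents dS dT E K"
    using kernel_imp_cptp[OF K] by blast
  have "\<Psi> = id_tensor dN dS dT E \<Phi>"
  proof (rule mat_eq_tensorI[OF assms id_tensor_carrier])
    fix x y x' y' assume "x < dN" "y < dT" "x' < dN" "y' < dT"
    then show "\<Psi> $$ (x * dT + y, x' * dT + y') = id_tensor dN dS dT E \<Phi> $$ (x * dT + y, x' * dT + y')"
      using eq[rule_format, of "(x, y)" "(x', y')"] by (simp add: id_tensor_eq_contract[OF E(2)])
  qed
  with E(1) show "\<exists>E. cptp dS dT E \<and> \<Psi> = id_tensor dN dS dT E \<Phi>" by blast
qed

section \<open>Projection onto the images under channels\<close>

text \<open>Tychonoff's theorem in the product topology carried by the function type.\<close>

lemma compact_Pi_UNIV: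
  fixes S :: "'i \<Rightarrow> 'b :: topological_space set"
  assumes "\<And>i. compact (S i)"
  shows "compact {f. \<forall>i. f i \<in> S i}"
proof -
  have "compactin (product_topology (\<lambda>i. euclidean) UNIV) (PiE UNIV S)"
    using assms by (simp add: compactin_PiE)
  also have "PiE UNIV S = {f. \<forall>i. f i \<in> S i}"
    by (auto simp: PiE_def Pi_def)
  finally show ?thesis by (simp add: euclidean_product_topology)
qed

lemma continuous_on_kernel_entry: "continuous_on X (\<lambda>K. K p q :: complex)"
  by (rule continuous_on_subset[of UNIV])
    (auto intro: continuous_on_product_then_coordinatewise)

text \<open>The diagonal entries are nonnegative, and those sharing the same \<open>s\<close> add up
  to 1.\<close>

lemma channel_kernel_norm_le:
  assumes fin: "finite S" "finite T" and K: "channel_kernel S T K" and pq: "p \<in> S \<times> T" "q \<in> S \<times> T"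
  shows "cmod (K p q) \<le> 1"
proof -
  have psd: "psd_on (S \<times> T) K" using K by (simp add: channel_kernel_def)
  have "Re (K r r) \<le> 1" if "r \<in> S \<times> T" for r
  proof -
    obtain s t where r: "r = (s, t)" "s \<in> S" "t \<in> T" using \<open>r \<in> S \<times> T\<close> by auto
    have "Re (K (s, t) (s, t)) \<le> (\<Sum>t\<in>T. Re (K (s, t) (s, t)))"
      using psd_on_diag[OF _ psd] fin r
      by (intro member_le_sum) (auto simp: less_eq_complex_def)
    also have "\<dots> = Re (\<Sum>t\<in>T. K (s, t) (s, t))" by simp
    also have "(\<Sum>t\<in>T. K (s, t) (s, t)) = 1" using K r by (simp add: channel_kernel_def)
    finally show ?thesis using r by simp
  qed
  from this[OF pq(1)] this[OF pq(2)] psd_on_norm_le[OF _ psd pq] fin show ?thesis by simp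
qed

text \<open>A closed subset of a product of unit discs. The bound is imposed on all entries because
  \<open>channel_kernel\<close> leaves those outside \<open>S \<times> T\<close> free.\<close>

lemma compact_channel_kernels:
  "compact {K. channel_kernel S T K \<and> (\<forall>p q. cmod (K p q) \<le> 1)}"
proof -
  have "compact {K :: 'a \<times> 'b \<Rightarrow> 'a \<times> 'b \<Rightarrow> complex. \<forall>p. K p \<in> {g. \<forall>q. g q \<in> cball 0 1}}"
    by (intro compact_Pi_UNIV compact_cball)
  moreover have "closed {K. psd_on (S \<times> T) K}"
    unfolding psd_on_def less_eq_complex_def
    by (intro closed_Collect_all closed_Collect_conj closed_Collect_le closed_Collect_eq
        continuous_intros continuous_on_kernel_entry)
  moreover have "closed {K. \<forall>s\<in>S. \<forall>s'\<in>S. (\<Sum>t\<in>T. K (s, t) (s', t) :: complex) = (if s = s' then 1 else 0)}"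
    unfolding Ball_def
    by (intro closed_Collect_all closed_Collect_imp closed_Collect_eq
        continuous_intros continuous_on_kernel_entry) auto
  ultimately have "compact ({K :: 'a \<times> 'b \<Rightarrow> 'a \<times> 'b \<Rightarrow> complex. \<forall>p. K p \<in> {g. \<forall>q. g q \<in> cball 0 1}} \<inter>
      ({K. psd_on (S \<times> T) K} \<inter>
        {K. \<forall>s\<in>S. \<forall>s'\<in>S. (\<Sum>t\<in>T. K (s, t) (s', t)) = (if s = s' then 1 else 0)}))"
    by (intro compact_Int_closed closed_Int)
  also have "\<dots> = {K. channel_kernel S T K \<and> (\<forall>p q. cmod (K p q) \<le> 1)}"
    by (auto simp: channel_kernel_def)
  finally show ?thesis .
qed

section \<open>Convexity of the set of channels, and nearest points\<close>

lemma channel_kernel_convex: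
  assumes "channel_kernel S T K" "channel_kernel S T K'" "0 \<le> c" "c \<le> 1"
  shows "channel_kernel S T (\<lambda>p q. of_real (1 - c) * K p q + of_real c * K' p q)"
proof -
  have "psd_on (S \<times> T) (\<lambda>p q. of_real (1 - c) * K p q + of_real c * K' p q)"
    using assms by (intro psd_on_add psd_on_scale) (auto simp: channel_kernel_def)
  then show ?thesis
    using assms unfolding channel_kernel_def
    by (auto simp: sum.distrib simp flip: sum_distrib_left)
qed

text \<open>The channel that discards \<open>S\<close> and prepares the basis state
  \<open>t0\<close>; it shows that there is something to project onto.\<close>

lemma channel_kernel_exists:
  assumes "finite S" "finite T" "t0 \<in> T"
  shows "channel_kernel S T (\<lambda>(s, t) (s', t'). if s = s' \<and> t = t0 \<and> t' = t0 then 1 else 0)"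
    (is "channel_kernel S T ?K")
proof -
  let ?w = "\<lambda>r (s, t). if s = r \<and> t = t0 then 1 else 0 :: complex"
  have "psd_on (S \<times> T) (\<lambda>p q. \<Sum>r\<in>S. ?w r p * cnj (?w r q))"
    by (intro psd_on_sum psd_on_rank_one)
  also have "?this \<longleftrightarrow> psd_on (S \<times> T) ?K"
  proof (rule psd_on_cong)
    fix p q assume "p \<in> S \<times> T"
    have "(\<Sum>r\<in>S. ?w r p * cnj (?w r q)) = (\<Sum>r\<in>S. if r = fst p then ?K p q else 0)"
      by (intro sum.cong) (auto simp: split_beta)
    also have "\<dots> = ?K p q"
      using assms(1) \<open>p \<in> S \<times> T\<close> by auto
    finally show "(\<Sum>r\<in>S. ?w r p * cnj (?w r q)) = ?K p q" .
  qed
  finally have "psd_on (S \<times> T) ?K" .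
  moreover have "(\<Sum>t\<in>T. ?K (s, t) (s', t)) = (if s = s' then 1 else 0)" for s s'
    using assms by (cases "s = s'") simp_all
  ultimately show ?thesis by (simp add: channel_kernel_def)
qed

lemma channel_kernel_cong:
  assumes "\<And>p q. p \<in> S \<times> T \<Longrightarrow> q \<in> S \<times> T \<Longrightarrow> K p q = K' p q"
  shows "channel_kernel S T K \<longleftrightarrow> channel_kernel S T K'"
  using psd_on_cong[of "S \<times> T" K K'] assms unfolding channel_kernel_def
  by (auto cong: sum.cong)

text \<open>First-order optimality: moving from \<open>x\<close> a fraction \<open>c\<close> of the
  way to \<open>y\<close> changes the squared distance to \<open>z\<close> by
  \<open>- 2 * c * a + c\<^sup>2 * b\<close>, which is negative for small \<open>c\<close> if
  \<open>a\<close> is positive.\<close>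

lemma nearest_point_variational:
  fixes x y z :: "'i \<Rightarrow> complex"
  assumes "\<And>c :: real. 0 < c \<Longrightarrow> c \<le> 1 \<Longrightarrow>
    (\<Sum>i\<in>I. (cmod (z i - x i))\<^sup>2) \<le> (\<Sum>i\<in>I. (cmod (z i - (of_real (1 - c) * x i + of_real c * y i)))\<^sup>2)"
  shows "Re (\<Sum>i\<in>I. cnj (z i - x i) * (y i - x i)) \<le> 0"
proof (rule ccontr)
  define a where "a = Re (\<Sum>i\<in>I. cnj (z i - x i) * (y i - x i))"
  define b where "b = (\<Sum>i\<in>I. (cmod (y i - x i))\<^sup>2)"
  assume "\<not> Re (\<Sum>i\<in>I. cnj (z i - x i) * (y i - x i)) \<le> 0"
  then have a: "a > 0" by (simp add: a_def)
  have b: "b \<ge> 0" by (simp add: b_def sum_nonneg)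
  have expand: "(\<Sum>i\<in>I. (cmod (z i - (of_real (1 - c) * x i + of_real c * y i)))\<^sup>2)
      = (\<Sum>i\<in>I. (cmod (z i - x i))\<^sup>2) - 2 * c * a + c\<^sup>2 * b" for c :: real
    unfolding a_def b_def Re_sum sum_distrib_left sum_subtractf[symmetric] sum.distrib[symmetric]
    by (intro sum.cong refl) (simp only: cmod_power2, simp add: power2_eq_square algebra_simps)
  have key: "2 * a \<le> c * b" if "0 < c" "c \<le> 1" for c
  proof -
    have "2 * c * a \<le> c\<^sup>2 * b" using assms[OF that] unfolding expand by simp
    then have "c * (2 * a) \<le> c * (c * b)" by (simp add: power2_eq_square mult_ac)
    with that show ?thesis by simp
  qed
  \<comment> \<open>Small enough that \<open>c * b \<le> a\<close>, against
    \<open>2 * a \<le> c * b\<close>; adding 1 to \<open>b\<close> keeps the denominator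
    positive.\<close>
  define c where "c = min 1 (a / (b + 1))"
  have "0 < c" "c \<le> 1" using a b by (auto simp: c_def)
  have "c * b \<le> a / (b + 1) * b" using b by (intro mult_right_mono) (auto simp: c_def)
  also have "\<dots> \<le> a" using a b by (simp add: field_simps)
  finally show False using key[OF \<open>0 < c\<close> \<open>c \<le> 1\<close>] a by simp
qed

text \<open>The squared distance attains its minimum by compactness, and the first-order condition
  at the minimiser says that the hyperplane through the nearest point, orthogonal to the difference,
  has all images on one side.\<close>

lemma contract_projection:
  assumes fin: "finite S" "finite T" and "T \<noteq> {}"
  obtains K where "channel_kernel S T K"
    "\<And>K'. channel_kernel S T K' \<Longrightarrow> Re (\<Sum>p\<in>N \<times> T. \<Sum>q\<in>N \<times> T.
       cnj (Z p q - contract S A K p q) * (contract S A K' p q - contract S A K p q)) \<le> 0"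
proof -
  define C where "C = {K. channel_kernel S T K \<and> (\<forall>p q. cmod (K p q) \<le> 1)}"
  define f where "f = (\<lambda>K. \<Sum>p\<in>N \<times> T. \<Sum>q\<in>N \<times> T. (cmod (Z p q - contract S A K p q))\<^sup>2)"
  \<comment> \<open>Truncation to \<open>S \<times> T\<close> brings any channel kernel into the
    compact set without changing the distance, so the minimum over \<open>C\<close> is one over all
    channel kernels.\<close>
  define R :: "('a \<times> 'b \<Rightarrow> 'a \<times> 'b \<Rightarrow> complex) \<Rightarrow> 'a \<times> 'b \<Rightarrow> 'a \<times> 'b \<Rightarrow> complex" where
    "R = (\<lambda>K p q. if p \<in> S \<times> T \<and> q \<in> S \<times> T then K p q else 0)"
  have R: "R K \<in> C" if "channel_kernel S T K" for K
  proof -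
    have "channel_kernel S T (R K)"
      using that by (subst channel_kernel_cong[of S T _ K]) (auto simp: R_def)
    then show ?thesis
      using channel_kernel_norm_le[OF fin that] by (auto simp: C_def R_def)
  qed
  have fR: "f (R K) = f K" for K
    unfolding f_def
    by (intro sum.cong refl) (auto simp: R_def cong: sum.cong)
  obtain t0 where "t0 \<in> T" using \<open>T \<noteq> {}\<close> by blast
  have "C \<noteq> {}" using R[OF channel_kernel_exists[OF fin \<open>t0 \<in> T\<close>]] by blast
  moreover have "compact C" unfolding C_def by (rule compact_channel_kernels)
  moreover have "continuous_on C f"
    unfolding f_def contract_def split_beta
    by (intro continuous_intros continuous_on_kernel_entry)
  ultimately obtain K where K: "K \<in> C" and min: "\<And>K'. K' \<in> C \<Longrightarrow> f K \<le> f K'"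
    using continuous_attains_inf by metis
  show thesis
  proof
    show chK: "channel_kernel S T K" using K by (simp add: C_def)
    fix K' assume K': "channel_kernel S T K'"
    have "Re (\<Sum>i\<in>(N \<times> T) \<times> (N \<times> T). cnj (case_prod Z i - case_prod (contract S A K) i)
        * (case_prod (contract S A K') i - case_prod (contract S A K) i)) \<le> 0"
    proof (rule nearest_point_variational)
      fix c :: real assume c: "0 < c" "c \<le> 1"
      define M where "M = (\<lambda>p q. of_real (1 - c) * K p q + of_real c * K' p q)"
      have "f K \<le> f (R M)"
        unfolding M_def using c by (intro min R channel_kernel_convex chK K') auto
      moreover have "contract S A M p q = of_real (1 - c) * contract S A K p q + of_real c * contract S A K' p q" for p q
        by (cases p; cases q) (simp add: M_def sum.distrib sum_distrib_left algebra_simps sum_subtractf)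
      ultimately have "(\<Sum>p\<in>N \<times> T. \<Sum>q\<in>N \<times> T. (cmod (Z p q - contract S A K p q))\<^sup>2)
        \<le> (\<Sum>p\<in>N \<times> T. \<Sum>q\<in>N \<times> T. (cmod (Z p q - (of_real (1 - c) * contract S A K p q + of_real c * contract S A K' p q)))\<^sup>2)"
        unfolding fR unfolding f_def by simp
      then show "(\<Sum>i\<in>(N \<times> T) \<times> (N \<times> T). (cmod (case_prod Z i - case_prod (contract S A K) i))\<^sup>2)
        \<le> (\<Sum>i\<in>(N \<times> T) \<times> (N \<times> T). (cmod (case_prod Z i -
            (of_real (1 - c) * case_prod (contract S A K) i + of_real c * case_prod (contract S A K') i)))\<^sup>2)"
        unfolding sum.cartesian_product by (simp add: split_beta)
    qed
    then show "Re (\<Sum>p\<in>N \<times> T. \<Sum>q\<in>N \<times> T.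
       cnj (Z p q - contract S A K p q) * (contract S A K' p q - contract S A K p q)) \<le> 0"
      unfolding sum.cartesian_product by (simp add: split_beta)
  qed
qed

section \<open>A unitary operator basis\<close>

text \<open>The index encodes a pair: \<open>i div d\<close> is the shift and \<open>i mod d\<close>
  the frequency of the phase. The support condition uses \<open>a + t\<close>, a reflected shift,
  which avoids subtraction and treats rows and columns alike.\<close>

definition weyl :: "nat \<Rightarrow> nat \<Rightarrow> nat \<Rightarrow> nat \<Rightarrow> complex" where
  "weyl d i a t = (if (a + t) mod d = i div d then cis (2 * pi * real (i mod d) * real t / real d) else 0)"

lemma mod_add_left_inj:
  fixes a b t d :: nat
  assumes "a < d" "b < d" "(a + t) mod d = (b + t) mod d"
  shows "a = b"
proof -
  have "y = x" if "x \<le> y" "y < d" "(y + t) mod d = (x + t) mod d" for x y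
  proof -
    have "d dvd y - x" using that mod_eq_dvd_iff_nat[of "x + t" "y + t" d] by simp
    then show ?thesis using that dvd_imp_le[of d "y - x"] by (cases "x < y") auto
  qed
  from this[of a b] this[of b a] show ?thesis using assms by force
qed

text \<open>Translation by \<open>a\<close> permutes the residues modulo \<open>d\<close>.\<close>

lemma sum_add_mod_delta:
  fixes a d p :: nat
  assumes "p < d"
  shows "(\<Sum>t<d. if (a + t) mod d = p then 1 else 0 :: complex) = 1"
proof -
  have inj: "inj_on (\<lambda>t. (a + t) mod d) {..<d}"
    by (rule inj_onI) (auto intro: mod_add_left_inj simp: add.commute[of a])
  have "(\<lambda>t. (a + t) mod d) ` {..<d} \<subseteq> {..<d}" using assms by auto
  then have "bij_betw (\<lambda>t. (a + t) mod d) {..<d} {..<d}"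
    using inj by (simp add: bij_betw_def endo_inj_surj)
  from sum.reindex_bij_betw[OF this, of "\<lambda>x. if x = p then 1 else 0 :: complex"]
  show ?thesis using assms by simp
qed

text \<open>One half of unitarity. Each column has a single nonzero entry, so different rows have
  disjoint supports, and the nonzero entries are phases.\<close>

lemma weyl_row_orthonormal:
  assumes "i < d * d" "a < d" "a' < d"
  shows "(\<Sum>t<d. weyl d i a t * cnj (weyl d i a' t)) = (if a = a' then 1 else 0)"
proof -
  have p: "i div d < d" using assms(1) by (rule less_mult_imp_div_less)
  have "a = a'" if "(a + t) mod d = i div d" "(a' + t) mod d = i div d" for t
    using mod_add_left_inj[OF assms(2,3)] that by metis
  then have "(\<Sum>t<d. weyl d i a t * cnj (weyl d i a' t))
      = (\<Sum>t<d. if a = a' then if (a + t) mod d = i div d then 1 else 0 else 0)"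
    by (intro sum.cong refl) (auto simp: weyl_def cis_cnj cis_mult)
  then show ?thesis using sum_add_mod_delta[OF p] by simp
qed

lemma weyl_column_orthonormal:
  assumes "i < d * d" "t < d" "t' < d"
  shows "(\<Sum>a<d. weyl d i a t * cnj (weyl d i a t')) = (if t = t' then 1 else 0)"
proof -
  have p: "i div d < d" using assms(1) by (rule less_mult_imp_div_less)
  have "t = t'" if "(t + a) mod d = i div d" "(t' + a) mod d = i div d" for a
    using mod_add_left_inj[OF assms(2,3)] that by metis
  then have "(\<Sum>a<d. weyl d i a t * cnj (weyl d i a t'))
      = (\<Sum>a<d. if t = t' then if (t + a) mod d = i div d then 1 else 0 else 0)"
    by (intro sum.cong refl) (auto simp: weyl_def cis_cnj cis_mult add.commute[of _ t] add.commute[of _ t'])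
  then show ?thesis using sum_add_mod_delta[OF p] by simp
qed

lemma sum_cis_root_of_unity:
  assumes "t < d" "t' < d"
  shows "(\<Sum>q<d. cis (2 * pi * real q * (real t - real t') / real d)) = (if t = t' then of_nat d else 0)"
proof (cases "t = t'")
  case False
  let ?z = "cis (2 * pi * (real t - real t') / real d)"
  have d: "real d > 0" using assms by simp
  \<comment> \<open>Otherwise \<open>t - t'\<close> would be a nonzero integer multiple of
    \<open>d\<close>, although its absolute value is below \<open>d\<close>.\<close>
  have "?z \<noteq> 1"
  proof
    assume "?z = 1"
    then have "cos (2 * pi * (real t - real t') / real d) = 1" by (simp add: complex_eq_iff)
    then obtain k :: int where "2 * pi * (real t - real t') / real d = of_int k * 2 * pi"
      by (auto simp: cos_one_2pi_int)
    then have "2 * pi * (real t - real t') = 2 * pi * (of_int k * real d)"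
      using d by (simp add: field_simps)
    then have "real t - real t' = of_int k * real d" by simp
    then have "real_of_int (int t - int t') = real_of_int (k * int d)" by simp
    then have "int t - int t' = k * int d" unfolding of_int_eq_iff .
    moreover have "\<bar>int t - int t'\<bar> < int d" using assms by auto
    ultimately have "k = 0" by (metis dvd_triv_right zdvd_not_zless
          linorder_not_le mult_eq_0_iff zero_less_abs_iff abs_of_nonneg dvd_abs_iff)
    then show False using \<open>int t - int t' = k * int d\<close> False by simp
  qed
  moreover have "?z ^ d = 1"
  proof -
    have "?z ^ d = cis (2 * pi * of_int (int t - int t'))"
      using d by (simp add: DeMoivre)
    then show ?thesis by simp
  qed
  moreover have "(\<Sum>q<d. cis (2 * pi * real q * (real t - real t') / real d)) = (\<Sum>q<d. ?z ^ q)"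
    by (intro sum.cong refl) (simp add: DeMoivre mult_ac)
  ultimately show ?thesis using False by (simp add: geometric_sum)
qed simp

text \<open>Completeness of the operator basis, needed for the Bell measurement to sum to the
  identity. The sum over frequencies enforces \<open>t = t'\<close>, and then equal shifts enforce
  \<open>a = a'\<close>.\<close>

lemma weyl_complete:
  assumes "a < d" "t < d" "a' < d" "t' < d"
  shows "(\<Sum>i<d * d. weyl d i a t * cnj (weyl d i a' t')) = (if a = a' \<and> t = t' then of_nat d else 0)"
proof -
  have "(\<Sum>i<d * d. weyl d i a t * cnj (weyl d i a' t'))
      = (\<Sum>p<d. if p = (a + t) mod d then if p = (a' + t') mod d then
          \<Sum>q<d. cis (2 * pi * real q * (real t - real t') / real d) else 0 else 0)"
    unfolding sum_tensor_index
    by (intro sum.cong refl) (auto simp: weyl_def cis_cnj cis_mult diff_divide_distrib right_diff_distrib intro!: sum.cong)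
  also have "\<dots> = (if (a + t) mod d = (a' + t') mod d then if t = t' then of_nat d else 0 else 0)"
    using assms by (simp add: sum_cis_root_of_unity)
  also have "\<dots> = (if a = a' \<and> t = t' then of_nat d else 0)"
    using mod_add_left_inj[OF assms(1,3), of t] by auto
  finally show ?thesis .
qed

section \<open>Payoffs\<close>

lemma bij_betw_prod_swap: "bij_betw prod.swap (A \<times> B) (B \<times> A)"
  by (rule bij_betw_byWitness[where f' = prod.swap]) auto

lemma is_povm_tensor_iff:
  "is_povm (m * d) k D \<longleftrightarrow> (\<forall>i<k. psd_op (m * d) (D i)) \<and>
    (\<forall>x<m. \<forall>y<d. \<forall>x'<m. \<forall>y'<d.
      (\<Sum>i<k. D i $$ (x * d + y, x' * d + y')) = (if x = x' \<and> y = y' then 1 else 0))"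
proof -
  let ?s = "\<lambda>p q. (\<Sum>i<k. D i $$ (p, q))"
  \<comment> \<open>Passing through a matrix equation lets \<open>mat_eq_tensorI\<close> change
    between flat and paired indices.\<close>
  have "(\<forall>p<m * d. \<forall>q<m * d. ?s p q = (if p = q then 1 else 0)) \<longleftrightarrow>
    mat (m * d) (m * d) (\<lambda>(p, q). ?s p q) = 1\<^sub>m (m * d)" (is "?L \<longleftrightarrow> ?M")
    by (auto simp: mat_eq_iff)
  also have "?M \<longleftrightarrow> (\<forall>x<m. \<forall>y<d. \<forall>x'<m. \<forall>y'<d.
      ?s (x * d + y) (x' * d + y') = (if x = x' \<and> y = y' then 1 else 0))" (is "_ \<longleftrightarrow> ?R")
  proof
    have eq: "x * d + y = x' * d + y' \<longleftrightarrow> x = x' \<and> y = y'"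
      if "x < m" "y < d" "x' < m" "y' < d" for x y x' y'
      using bij_betw_tensor_index[of d m] that unfolding bij_betw_def inj_on_def by fastforce
    {
      assume M: ?M
      show ?R
      proof (intro allI impI)
        fix x y x' y' assume *: "x < m" "y < d" "x' < m" "y' < d"
        have "?s (x * d + y) (x' * d + y') = 1\<^sub>m (m * d) $$ (x * d + y, x' * d + y')"
          unfolding M[symmetric] using * by (simp add: tensor_index_less)
        then show "?s (x * d + y) (x' * d + y') = (if x = x' \<and> y = y' then 1 else 0)"
          using * eq[OF *] by (simp add: tensor_index_less)
      qed
    next
      assume ?R
      then show ?M by (intro mat_eq_tensorI) (auto simp: tensor_index_less eq)
    }
  qed
  finally show ?thesis by (simp add: is_povm_def)
qed

lemma povm_norm_le:
  assumes "is_povm d k D" "i < k" "p < d" "q < d"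
  shows "cmod (D i $$ (p, q)) \<le> 1"
proof -
  have psd: "psd_on {..<d} (\<lambda>p q. D j $$ (p, q))" if "j < k" for j
    using assms(1) that by (simp add: is_povm_def psd_op_iff)
  have "Re (D i $$ (r, r)) \<le> 1" if "r < d" for r
  proof -
    have "Re (D i $$ (r, r)) \<le> (\<Sum>j<k. Re (D j $$ (r, r)))"
      using psd_on_diag[OF _ psd] that assms(2)
      by (intro member_le_sum) (auto simp: less_eq_complex_def)
    also have "\<dots> = Re (\<Sum>j<k. D j $$ (r, r))" by simp
    also have "(\<Sum>j<k. D j $$ (r, r)) = 1" using assms(1) that by (simp add: is_povm_def)
    finally show ?thesis by simp
  qed
  from this[OF assms(3)] this[OF assms(4)] psd_on_norm_le[OF _ psd[OF assms(2)], of p q] assms(3,4)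
  show ?thesis by simp
qed

text \<open>Makes the suprema in \<open>opt_payoff\<close> genuine: entries of measurement operators
  have modulus at most 1, so the moduli of the remaining coefficients sum to a bound independent of
  the strategy.\<close>

lemma bdd_above_payoff:
  "bdd_above {payoff dN dS dA dB \<Phi> \<rho> k M D | D. is_povm (dS * dA) k D}"
proof (rule bdd_aboveI, clarify)
  fix D assume D: "is_povm (dS * dA) k D"
  let ?c = "\<lambda>i n s a b n' s' a' b'. \<Phi> $$ (n * dS + s, n' * dS + s') * \<rho> $$ (a * dB + b, a' * dB + b')
       * M i $$ (n' * dB + b', n * dB + b)"
  have "payoff dN dS dA dB \<Phi> \<rho> k M D \<le> cmod (\<Sum>i<k.
     \<Sum>n<dN. \<Sum>s<dS. \<Sum>a<dA. \<Sum>b<dB. \<Sum>n'<dN. \<Sum>s'<dS. \<Sum>a'<dA. \<Sum>b'<dB.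
       ?c i n s a b n' s' a' b' * D i $$ (s' * dA + a', s * dA + a))"
    unfolding payoff_def by (rule complex_Re_le_cmod)
  also have "\<dots> \<le> (\<Sum>i<k.
     \<Sum>n<dN. \<Sum>s<dS. \<Sum>a<dA. \<Sum>b<dB. \<Sum>n'<dN. \<Sum>s'<dS. \<Sum>a'<dA. \<Sum>b'<dB.
       cmod (?c i n s a b n' s' a' b'))"
  proof (intro sum_norm_le)
    fix i n s a b n' s' a' b'
    assume "i \<in> {..<k}" "s \<in> {..<dS}" "a \<in> {..<dA}" "s' \<in> {..<dS}" "a' \<in> {..<dA}"
    then have "cmod (D i $$ (s' * dA + a', s * dA + a)) \<le> 1"
      by (intro povm_norm_le[OF D]) (auto simp: tensor_index_less)
    then show "cmod (?c i n s a b n' s' a' b' * D i $$ (s' * dA + a', s * dA + a))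
        \<le> cmod (?c i n s a b n' s' a' b')"
      unfolding norm_mult[of "?c i n s a b n' s' a' b'"] by (intro mult_left_le) auto
  qed
  finally show "payoff dN dS dA dB \<Phi> \<rho> k M D \<le> (\<Sum>i<k.
     \<Sum>n<dN. \<Sum>s<dS. \<Sum>a<dA. \<Sum>b<dB. \<Sum>n'<dN. \<Sum>s'<dS. \<Sum>a'<dA. \<Sum>b'<dB.
       cmod (?c i n s a b n' s' a' b'))" .
qed

text \<open>Always announcing outcome 0 is a strategy; this keeps the suprema from ranging over the
  empty set.\<close>

lemma povm_exists:
  assumes "k \<ge> 1"
  shows "\<exists>D. is_povm d k D"
proof
  let ?D = "\<lambda>i. if i = 0 then 1\<^sub>m d else 0\<^sub>m d d :: complex mat"
  have "psd_on {..<d} (\<lambda>i j. 1\<^sub>m d $$ (i, j))"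
    unfolding psd_on_def
  proof
    fix v :: "nat \<Rightarrow> complex"
    have "(\<Sum>i<d. \<Sum>j<d. cnj (v i) * 1\<^sub>m d $$ (i, j) * v j) = (\<Sum>i<d. \<Sum>j<d. if j = i then cnj (v i) * v i else 0)"
      by (intro sum.cong refl) auto
    also have "\<dots> = (\<Sum>i<d. cnj (v i) * v i)" by simp
    also have "0 \<le> \<dots>" by (intro sum_nonneg cnj_mult_self_nonneg)
    finally show "0 \<le> (\<Sum>i<d. \<Sum>j<d. cnj (v i) * 1\<^sub>m d $$ (i, j) * v j)" .
  qed
  moreover have "psd_on {..<d} (\<lambda>i j. 0\<^sub>m d d $$ (i, j))"
    by (simp add: psd_on_def)
  moreover have "(\<Sum>i<k. ?D i $$ (a, b)) = (if a = b then 1 else 0)" if "a < d" "b < d" for a b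
  proof -
    have "(\<Sum>i<k. ?D i $$ (a, b)) = (\<Sum>i<k. if i = 0 then if a = b then 1 else 0 else 0)"
      using that by (intro sum.cong) auto
    then show ?thesis using assms by simp
  qed
  ultimately show "is_povm d k ?D"
    by (auto simp: is_povm_def psd_op_iff)
qed

text \<open>Isolates the innermost sum over \<open>s\<close> and \<open>s'\<close>, the only place
  where information structure and strategy enter. Strategies agreeing there have equal
  payoffs.\<close>

lemma payoff_regroup:
  "payoff dN dS dA dB \<Phi> \<rho> k M D = Re (\<Sum>i<k.
     \<Sum>n<dN. \<Sum>a<dA. \<Sum>n'<dN. \<Sum>a'<dA. \<Sum>b<dB. \<Sum>b'<dB.
       \<rho> $$ (a * dB + b, a' * dB + b') * (M i $$ (n' * dB + b', n * dB + b)
       * (\<Sum>s<dS. \<Sum>s'<dS. \<Phi> $$ (n * dS + s, n' * dS + s') * D i $$ (s' * dA + a', s * dA + a))))"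
proof -
  have "(\<Sum>n<dN. \<Sum>s<dS. \<Sum>a<dA. \<Sum>b<dB. \<Sum>n'<dN. \<Sum>s'<dS. \<Sum>a'<dA. \<Sum>b'<dB.
       \<Phi> $$ (n * dS + s, n' * dS + s') * \<rho> $$ (a * dB + b, a' * dB + b')
       * M i $$ (n' * dB + b', n * dB + b) * D i $$ (s' * dA + a', s * dA + a))
    = (\<Sum>n<dN. \<Sum>a<dA. \<Sum>n'<dN. \<Sum>a'<dA. \<Sum>b<dB. \<Sum>b'<dB.
       \<rho> $$ (a * dB + b, a' * dB + b') * (M i $$ (n' * dB + b', n * dB + b)
       * (\<Sum>s<dS. \<Sum>s'<dS. \<Phi> $$ (n * dS + s, n' * dS + s') * D i $$ (s' * dA + a', s * dA + a))))" for i
    unfolding sum_distrib_left sum.cartesian_product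
    by (rule sum.reindex_bij_witness[where i = "\<lambda>(n, a, n', a', b, b', s, s'). (n, s, a, b, n', s', a', b')"
          and j = "\<lambda>(n, s, a, b, n', s', a', b'). (n, a, n', a', b, b', s, s')"]) (simp_all add: split_beta mem_Times_iff mult_ac)
  then show ?thesis unfolding payoff_def by (simp only:)
qed

section \<open>From a channel to better payoffs\<close>

lemma kernel_imp_better:
  assumes K: "channel_kernel {..<dS} {..<dT} K"
    and eq: "\<And>n t n' t'. n < dN \<Longrightarrow> t < dT \<Longrightarrow> n' < dN \<Longrightarrow> t' < dT \<Longrightarrow> \<Psi> $$ (n * dT + t, n' * dT + t')
      = (\<Sum>s<dS. \<Sum>s'<dS. \<Phi> $$ (n * dS + s, n' * dS + s') * K (s', t') (s, t))"
  shows "better dN dS dT \<Phi> \<Psi>"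
  unfolding better_def
proof (intro allI impI, elim conjE)
  fix dA dB k :: nat and \<rho> and M :: "nat \<Rightarrow> complex mat"
  assume "k \<ge> 1"
  have "\<exists>D'. is_povm (dS * dA) k D' \<and>
    payoff dN dT dA dB \<Psi> \<rho> k M D = payoff dN dS dA dB \<Phi> \<rho> k M D'"
    if D: "is_povm (dT * dA) k D" for D
  proof (intro exI conjI)
    \<comment> \<open>The dual channel applied to the \<open>T\<close> factor of the measurement.\<close>
    define D' where "D' = (\<lambda>i. tensor_mat dS dA (\<lambda>(s', a') (s, a).
      \<Sum>t'<dT. \<Sum>t<dT. D i $$ (t' * dA + a', t * dA + a) * K (s', t') (s, t)))"
    have "psd_op (dS * dA) (D' i)" if "i < k" for i
    proof -
      \<comment> \<open>Up to swapping factors, \<open>D' i\<close> is a contraction over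
        \<open>T\<close>: of \<open>D i\<close> with its factors swapped against the transpose of
        \<open>K\<close> with its factors swapped.\<close>
      let ?B = "\<lambda>(a, t) (a', t'). D i $$ (t * dA + a, t' * dA + a')"
      let ?L = "\<lambda>(t, s) (t', s'). K (s', t') (s, t)"
      have "psd_on ({..<dT} \<times> {..<dA}) (tensor_entry dA (D i))"
        using D \<open>i < k\<close> by (simp add: is_povm_def psd_op_tensor_iff)
      from psd_on_reindex[OF this bij_betw_prod_swap]
      have B: "psd_on ({..<dA} \<times> {..<dT}) ?B"
        by (rule psd_on_cong[THEN iffD1, rotated]) auto
      have "psd_on ({..<dS} \<times> {..<dT}) K"
        using K by (simp add: channel_kernel_def)
      then have "psd_on ({..<dS} \<times> {..<dT}) (\<lambda>p q. K q p)"
        by (rule psd_on_transpose)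
      from psd_on_reindex[OF this bij_betw_prod_swap]
      have L: "psd_on ({..<dT} \<times> {..<dS}) ?L"
        by (rule psd_on_cong[THEN iffD1, rotated]) auto
      have "psd_on ({..<dA} \<times> {..<dS}) (contract {..<dT} ?B ?L)"
        by (intro psd_on_contract B L) auto
      from psd_on_reindex[OF this bij_betw_prod_swap]
      show ?thesis
        unfolding D'_def psd_op_tensor_mat_iff
        by (rule psd_on_cong[THEN iffD1, rotated]) auto
    qed
    moreover have "(\<Sum>i<k. D' i $$ (s' * dA + a', s * dA + a)) = (if s' = s \<and> a' = a then 1 else 0)"
      if *: "s' < dS" "a' < dA" "s < dS" "a < dA" for s' a' s a
    proof -
      have "(\<Sum>i<k. D' i $$ (s' * dA + a', s * dA + a))
          = (\<Sum>i<k. \<Sum>t'<dT. \<Sum>t<dT. D i $$ (t' * dA + a', t * dA + a) * K (s', t') (s, t))"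
        using * by (simp add: D'_def)
      also have "\<dots> = (\<Sum>t'<dT. \<Sum>t<dT. \<Sum>i<k. D i $$ (t' * dA + a', t * dA + a) * K (s', t') (s, t))"
        by (subst sum.swap, rule sum.cong[OF refl], rule sum.swap)
      also have "\<dots> = (\<Sum>t'<dT. \<Sum>t<dT. if t = t' then (if a' = a then 1 else 0) * K (s', t') (s, t') else 0)"
        using D * by (intro sum.cong refl) (auto simp: is_povm_tensor_iff simp flip: sum_distrib_right)
      also have "\<dots> = (if a' = a then 1 else 0) * (\<Sum>t'<dT. K (s', t') (s, t'))"
        by (simp add: sum_distrib_left)
      also have "\<dots> = (if s' = s \<and> a' = a then 1 else 0)"
        using K * by (simp add: channel_kernel_def)
      finally show ?thesis .
    qed
    ultimately show "is_povm (dS * dA) k D'" by (simp add: is_povm_tensor_iff)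
    have "(\<Sum>t<dT. \<Sum>t'<dT. \<Psi> $$ (n * dT + t, n' * dT + t') * D i $$ (t' * dA + a', t * dA + a))
        = (\<Sum>s<dS. \<Sum>s'<dS. \<Phi> $$ (n * dS + s, n' * dS + s') * D' i $$ (s' * dA + a', s * dA + a))"
      if "n < dN" "n' < dN" "a < dA" "a' < dA" for n n' a a' i
    proof -
      have "(\<Sum>t<dT. \<Sum>t'<dT. \<Psi> $$ (n * dT + t, n' * dT + t') * D i $$ (t' * dA + a', t * dA + a))
        = (\<Sum>t<dT. \<Sum>t'<dT. \<Sum>s<dS. \<Sum>s'<dS. \<Phi> $$ (n * dS + s, n' * dS + s') * K (s', t') (s, t)
            * D i $$ (t' * dA + a', t * dA + a))"
        using that by (intro sum.cong refl) (simp add: eq sum_distrib_right)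
      also have "\<dots> = (\<Sum>s<dS. \<Sum>s'<dS. \<Sum>t'<dT. \<Sum>t<dT. \<Phi> $$ (n * dS + s, n' * dS + s')
            * (D i $$ (t' * dA + a', t * dA + a) * K (s', t') (s, t)))"
        unfolding sum.cartesian_product
        by (rule sum.reindex_bij_witness[where i = "\<lambda>(s, s', t', t). (t, t', s, s')"
              and j = "\<lambda>(t, t', s, s'). (s, s', t', t)"]) (simp_all add: split_beta mem_Times_iff mult_ac)
      also have "\<dots> = (\<Sum>s<dS. \<Sum>s'<dS. \<Phi> $$ (n * dS + s, n' * dS + s') * D' i $$ (s' * dA + a', s * dA + a))"
        using that by (intro sum.cong refl) (simp add: D'_def sum_distrib_left)
      finally show ?thesis .
    qed
    then show "payoff dN dT dA dB \<Psi> \<rho> k M D = payoff dN dS dA dB \<Phi> \<rho> k M D'"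
      unfolding payoff_regroup by (intro arg_cong[where f = Re] sum.cong refl) simp
  qed
  then have sub: "{payoff dN dT dA dB \<Psi> \<rho> k M D | D. is_povm (dT * dA) k D}
      \<subseteq> {payoff dN dS dA dB \<Phi> \<rho> k M D | D. is_povm (dS * dA) k D}" by blast
  show "opt_payoff dN dT dA dB \<Psi> \<rho> k M \<le> opt_payoff dN dS dA dB \<Phi> \<rho> k M"
    unfolding opt_payoff_def
    using povm_exists[OF \<open>k \<ge> 1\<close>, of "dT * dA"]
    by (intro cSup_subset_mono bdd_above_payoff sub) blast
qed

section \<open>The teleportation game\<close>

definition entangled_state :: "nat \<Rightarrow> complex mat" where
  "entangled_state d = tensor_mat d d (\<lambda>(a, b) (a', b'). if a = b \<and> a' = b' then 1 / of_nat d else 0)"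

text \<open>The Weyl operator conjugates the second factor of \<open>G\<close> only.\<close>

definition teleport_payoff :: "nat \<Rightarrow> nat \<Rightarrow> (nat \<times> nat \<Rightarrow> nat \<times> nat \<Rightarrow> complex) \<Rightarrow> nat \<Rightarrow> complex mat" where
  "teleport_payoff dN d G i = tensor_mat dN d (\<lambda>(n', a') (n, a).
     \<Sum>t'<d. \<Sum>t<d. weyl d i a' t' * G (n', t') (n, t) * cnj (weyl d i a t))"

text \<open>The channel implemented by measuring \<open>D\<close> jointly with half of the entangled state and undoing the
  Weyl operator named by the outcome on the other half.\<close>

definition teleport_kernel :: "nat \<Rightarrow> (nat \<Rightarrow> complex mat) \<Rightarrow> nat \<times> nat \<Rightarrow> nat \<times> nat \<Rightarrow> complex" where
  "teleport_kernel d D = (\<lambda>(s', t') (s, t). (\<Sum>i<d * d. \<Sum>a'<d. \<Sum>a<d.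
     weyl d i a' t' * cnj (weyl d i a t) * D i $$ (s' * d + a', s * d + a)) / of_nat d)"

text \<open>Projections onto the generalised Bell basis. The vectors are conjugated Weyl matrices,
  so that the factors in \<open>teleport_kernel\<close> cancel against them.\<close>

definition bell_measurement :: "nat \<Rightarrow> nat \<Rightarrow> complex mat" where
  "bell_measurement d i = tensor_mat d d (\<lambda>(t', a') (t, a).
     of_real (1 / real d) * (cnj (weyl d i a' t') * weyl d i a t))"

lemma density_op_entangled_state:
  assumes "d > 0"
  shows "density_op (d * d) (entangled_state d)"
proof -
  let ?w = "\<lambda>(a, b). if a = b then 1 else 0 :: complex"
  have "psd_on ({..<d} \<times> {..<d}) (\<lambda>p q. of_real (1 / real d) * (?w p * cnj (?w q)))"
    by (intro psd_on_scale psd_on_rank_one) simp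
  then have "psd_op (d * d) (entangled_state d)"
    unfolding entangled_state_def psd_op_tensor_mat_iff
    by (rule psd_on_cong[THEN iffD1, rotated]) auto
  moreover have "mtrace (entangled_state d) = 1"
  proof -
    have "dim_row (entangled_state d) = d * d"
      by (simp add: entangled_state_def tensor_mat_def)
    then have "mtrace (entangled_state d) = (\<Sum>a<d. \<Sum>b<d. if b = a then 1 / of_nat d else 0)"
      unfolding mtrace_def by (simp add: sum_tensor_index entangled_state_def cong: sum.cong) (auto intro!: sum.cong)
    then show ?thesis using assms by simp
  qed
  ultimately show ?thesis by (simp add: density_op_def)
qed

lemma hermitian_op_teleport_payoff:
  assumes "\<And>p q. p \<in> {..<dN} \<times> {..<d} \<Longrightarrow> q \<in> {..<dN} \<times> {..<d} \<Longrightarrow> G q p = cnj (G p q)"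
  shows "hermitian_op (dN * d) (teleport_payoff dN d G i)"
proof -
  let ?M = "teleport_payoff dN d G i"
  have car: "?M \<in> carrier_mat (dN * d) (dN * d)" by (simp add: teleport_payoff_def)
  have "?M = mat (dN * d) (dN * d) (\<lambda>(p, q). cnj (?M $$ (q, p)))"
  proof (rule mat_eq_tensorI[OF car])
    fix n a n' a' assume *: "n < dN" "a < d" "n' < dN" "a' < d"
    have "(\<Sum>t<d. \<Sum>t'<d. weyl d i a t * G (n, t) (n', t') * cnj (weyl d i a' t'))
        = (\<Sum>t<d. \<Sum>t'<d. weyl d i a t * cnj (G (n', t') (n, t)) * cnj (weyl d i a' t'))"
      using * by (intro sum.cong refl) (simp add: assms[of "(n', _)" "(n, _)"])
    also have "\<dots> = cnj (\<Sum>t'<d. \<Sum>t<d. weyl d i a' t' * G (n', t') (n, t) * cnj (weyl d i a t))"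
      by (subst sum.swap) (simp add: mult_ac)
    finally show "?M $$ (n * d + a, n' * d + a')
        = mat (dN * d) (dN * d) (\<lambda>(p, q). cnj (?M $$ (q, p))) $$ (n * d + a, n' * d + a')"
      using * by (simp add: tensor_index_less) (simp add: teleport_payoff_def)
  qed simp
  then have "?M $$ (p, q) = cnj (?M $$ (q, p))" if "p < dN * d" "q < dN * d" for p q
    using that by (metis (no_types, lifting) case_prod_conv index_mat(1))
  with car show ?thesis unfolding hermitian_op_def by blast
qed

text \<open>Positivity holds because \<open>D i\<close> is contracted with a rank-one kernel for
  each outcome. For the trace, row orthonormality forces \<open>a = a'\<close>, completeness of the
  measurement removes the outcomes, and the \<open>d\<close> remaining equal terms cancel the factor
  \<open>1 / d\<close>.\<close>

lemma channel_kernel_teleport: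
  assumes "d > 0" and D: "is_povm (dS * d) (d * d) D"
  shows "channel_kernel {..<dS} {..<d} (teleport_kernel d D)"
proof -
  let ?U = "\<lambda>i (a, t). cnj (weyl d i a t)"
  have "psd_on ({..<dS} \<times> {..<d}) (\<lambda>p q. of_real (1 / real d) *
      (\<Sum>i<d * d. contract {..<d} (tensor_entry d (D i)) (\<lambda>p q. ?U i p * cnj (?U i q)) p q))"
    using D by (intro psd_on_scale psd_on_sum psd_on_contract psd_on_rank_one)
      (auto simp: is_povm_def psd_op_tensor_iff)
  then have "psd_on ({..<dS} \<times> {..<d}) (teleport_kernel d D)"
    by (rule psd_on_cong[THEN iffD1, rotated]) (auto simp: teleport_kernel_def mult_ac)
  moreover have "(\<Sum>t<d. teleport_kernel d D (s', t) (s, t)) = (if s' = s then 1 else 0)"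
    if "s' < dS" "s < dS" for s' s
  proof -
    have "(\<Sum>t<d. teleport_kernel d D (s', t) (s, t))
      = (\<Sum>t<d. \<Sum>i<d * d. \<Sum>a'<d. \<Sum>a<d.
          weyl d i a' t * cnj (weyl d i a t) * D i $$ (s' * d + a', s * d + a)) / of_nat d"
      by (simp add: teleport_kernel_def sum_divide_distrib)
    also have "(\<Sum>t<d. \<Sum>i<d * d. \<Sum>a'<d. \<Sum>a<d.
          weyl d i a' t * cnj (weyl d i a t) * D i $$ (s' * d + a', s * d + a))
      = (\<Sum>i<d * d. \<Sum>a'<d. \<Sum>a<d. \<Sum>t<d.
          weyl d i a' t * cnj (weyl d i a t) * D i $$ (s' * d + a', s * d + a))"
      unfolding sum.cartesian_product
      by (rule sum.reindex_bij_witness[where i = "\<lambda>(i, a', a, t). (t, i, a', a)"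
            and j = "\<lambda>(t, i, a', a). (i, a', a, t)"])
        (simp_all add: split_beta mem_Times_iff)
    also have "\<dots> = (\<Sum>i<d * d. \<Sum>a'<d. \<Sum>a<d. if a = a' then D i $$ (s' * d + a, s * d + a) else 0)"
      by (intro sum.cong refl) (auto simp: weyl_row_orthonormal simp flip: sum_distrib_right)
    also have "\<dots> = (\<Sum>i<d * d. \<Sum>a<d. D i $$ (s' * d + a, s * d + a))"
      by simp
    also have "\<dots> = (\<Sum>a<d. \<Sum>i<d * d. D i $$ (s' * d + a, s * d + a))"
      by (rule sum.swap)
    also have "\<dots> = (\<Sum>a<d. if s' = s then 1 else 0)"
      using D that by (intro sum.cong refl) (simp add: is_povm_tensor_iff)
    finally show ?thesis using assms(1) by simp
  qed
  ultimately show ?thesis by (simp add: channel_kernel_def)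
qed

lemma is_povm_bell_measurement:
  assumes "d > 0"
  shows "is_povm (d * d) (d * d) (bell_measurement d)"
proof -
  have "psd_op (d * d) (bell_measurement d i)" for i
  proof -
    let ?U = "\<lambda>(t, a). cnj (weyl d i a t)"
    have "psd_on ({..<d} \<times> {..<d}) (\<lambda>p q. of_real (1 / real d) * (?U p * cnj (?U q)))"
      by (intro psd_on_scale psd_on_rank_one) simp
    then show ?thesis
      unfolding bell_measurement_def psd_op_tensor_mat_iff
      by (rule psd_on_cong[THEN iffD1, rotated]) auto
  qed
  moreover have "(\<Sum>i<d * d. bell_measurement d i $$ (t' * d + a', t * d + a)) = (if t' = t \<and> a' = a then 1 else 0)"
    if "t' < d" "a' < d" "t < d" "a < d" for t' a' t a
  proof -
    have "(\<Sum>i<d * d. bell_measurement d i $$ (t' * d + a', t * d + a))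
      = of_real (1 / real d) * (\<Sum>i<d * d. weyl d i a t * cnj (weyl d i a' t'))"
      using that by (simp add: bell_measurement_def sum_distrib_left mult.commute[of "cnj _"])
    also have "\<dots> = (if t' = t \<and> a' = a then 1 else 0)"
      using that assms by (auto simp: weyl_complete)
    finally show ?thesis .
  qed
  ultimately show ?thesis by (simp add: is_povm_tensor_iff)
qed

text \<open>Teleportation implements the identity channel. By column orthonormality each of the
  \<open>d * d\<close> outcomes contributes \<open>1 / d\<close>, and the kernel carries another
  factor \<open>1 / d\<close>.\<close>

lemma teleport_kernel_bell_measurement:
  assumes "d > 0" "r' < d" "t' < d" "r < d" "t < d"
  shows "teleport_kernel d (bell_measurement d) (r', t') (r, t) = (if r' = t' \<and> r = t then 1 else 0)"
proof -
  have key: "(\<Sum>a'<d. \<Sum>a<d. weyl d i a' t' * cnj (weyl d i a t) * bell_measurement d i $$ (r' * d + a', r * d + a))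
      = of_real (1 / real d) * (if r' = t' \<and> r = t then 1 else 0)" if "i < d * d" for i
  proof -
    have "(\<Sum>a'<d. \<Sum>a<d. weyl d i a' t' * cnj (weyl d i a t) * bell_measurement d i $$ (r' * d + a', r * d + a))
      = (\<Sum>a'<d. \<Sum>a<d. of_real (1 / real d) * ((weyl d i a' t' * cnj (weyl d i a' r')) * (weyl d i a r * cnj (weyl d i a t))))"
      using assms by (intro sum.cong refl) (simp add: bell_measurement_def)
    also have "\<dots> = of_real (1 / real d) *
        ((\<Sum>a'<d. weyl d i a' t' * cnj (weyl d i a' r')) * (\<Sum>a<d. weyl d i a r * cnj (weyl d i a t)))"
      by (simp only: sum_product) (simp only: sum_distrib_left)
    also have "\<dots> = of_real (1 / real d) * (if r' = t' \<and> r = t then 1 else 0)"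
      using assms that by (auto simp: weyl_column_orthonormal)
    finally show ?thesis .
  qed
  have "teleport_kernel d (bell_measurement d) (r', t') (r, t)
      = (\<Sum>i<d * d. of_real (1 / real d) * (if r' = t' \<and> r = t then 1 else 0)) / of_nat d"
    unfolding teleport_kernel_def prod.case
    by (intro arg_cong[where f = "\<lambda>x. x / of_nat d"] sum.cong[OF refl] key) simp
  then show ?thesis using assms(1) by simp
qed

text \<open>The Weyl operators can be moved from the payoff operators onto the measurement, where
  they assemble the teleportation channel. A strategy thus earns the pairing of \<open>G\<close>
  with the image of \<open>\<Phi>\<close> under its channel.\<close>

lemma payoff_teleport:
  "payoff dN dS d d \<Phi> (entangled_state d) (d * d) (teleport_payoff dN d G) D
    = Re (\<Sum>p\<in>{..<dN} \<times> {..<d}. \<Sum>q\<in>{..<dN} \<times> {..<d}.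
        G q p * contract {..<dS} (tensor_entry dS \<Phi>) (teleport_kernel d D) p q)"
proof -
  define F where "F = (\<lambda>i n a n' a'. \<Sum>s<dS. \<Sum>s'<dS. \<Phi> $$ (n * dS + s, n' * dS + s') * D i $$ (s' * d + a', s * d + a))"
  \<comment> \<open>The entangled state identifies the indices of \<open>A\<close> and
    \<open>B\<close>, with weight \<open>1 / d\<close>.\<close>
  have collapse: "(\<Sum>b<d. \<Sum>b'<d. entangled_state d $$ (a * d + b, a' * d + b') * f b b') = f a a' / of_nat d"
    if "a < d" "a' < d" for a a' and f :: "nat \<Rightarrow> nat \<Rightarrow> complex"
  proof -
    have "(\<Sum>b<d. \<Sum>b'<d. entangled_state d $$ (a * d + b, a' * d + b') * f b b')
        = (\<Sum>b<d. \<Sum>b'<d. if b' = a' then if b = a then f a a' / of_nat d else 0 else 0)"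
      using that by (intro sum.cong refl) (auto simp: entangled_state_def)
    then show ?thesis using that by simp
  qed
  have "payoff dN dS d d \<Phi> (entangled_state d) (d * d) (teleport_payoff dN d G) D
    = Re (\<Sum>i<d * d. \<Sum>n<dN. \<Sum>a<d. \<Sum>n'<dN. \<Sum>a'<d.
        teleport_payoff dN d G i $$ (n' * d + a', n * d + a) * F i n a n' a' / of_nat d)"
    unfolding payoff_regroup F_def
    by (intro arg_cong[where f = Re] sum.cong refl) (simp add: collapse)
  also have "(\<Sum>i<d * d. \<Sum>n<dN. \<Sum>a<d. \<Sum>n'<dN. \<Sum>a'<d.
        teleport_payoff dN d G i $$ (n' * d + a', n * d + a) * F i n a n' a' / of_nat d)
    = (\<Sum>i<d * d. \<Sum>n<dN. \<Sum>a<d. \<Sum>n'<dN. \<Sum>a'<d. \<Sum>s<dS. \<Sum>s'<dS. \<Sum>t'<d. \<Sum>t<d.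
        weyl d i a' t' * G (n', t') (n, t) * cnj (weyl d i a t)
        * (\<Phi> $$ (n * dS + s, n' * dS + s') * D i $$ (s' * d + a', s * d + a)) / of_nat d)"
    by (intro sum.cong refl)
      (simp add: teleport_payoff_def F_def sum_distrib_left sum_distrib_right sum_divide_distrib)
  also have "\<dots> = (\<Sum>n<dN. \<Sum>t<d. \<Sum>n'<dN. \<Sum>t'<d. \<Sum>s<dS. \<Sum>s'<dS. \<Sum>i<d * d. \<Sum>a'<d. \<Sum>a<d.
        G (n', t') (n, t) * (\<Phi> $$ (n * dS + s, n' * dS + s') *
        (weyl d i a' t' * cnj (weyl d i a t) * D i $$ (s' * d + a', s * d + a) / of_nat d)))"
    unfolding sum.cartesian_product
    by (rule sum.reindex_bij_witness[where
          i = "\<lambda>(n, t, n', t', s, s', i, a', a). (i, n, a, n', a', s, s', t', t)" and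
          j = "\<lambda>(i, n, a, n', a', s, s', t', t). (n, t, n', t', s, s', i, a', a)"]) (simp_all add: split_beta mem_Times_iff mult_ac)
  also have "\<dots> = (\<Sum>p\<in>{..<dN} \<times> {..<d}. \<Sum>q\<in>{..<dN} \<times> {..<d}.
        G q p * contract {..<dS} (tensor_entry dS \<Phi>) (teleport_kernel d D) p q)"
    by (simp add: sum.cartesian_product' teleport_kernel_def sum_distrib_left sum_divide_distrib)
  finally show ?thesis .
qed

lemma payoff_bell_measurement:
  assumes "d > 0"
  shows "payoff dN d d d \<Psi> (entangled_state d) (d * d) (teleport_payoff dN d G) (bell_measurement d)
    = Re (\<Sum>p\<in>{..<dN} \<times> {..<d}. \<Sum>q\<in>{..<dN} \<times> {..<d}. G q p * tensor_entry d \<Psi> p q)"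
proof -
  have "contract {..<d} (tensor_entry d \<Psi>) (teleport_kernel d (bell_measurement d)) p q = tensor_entry d \<Psi> p q"
    if mem: "p \<in> {..<dN} \<times> {..<d}" "q \<in> {..<dN} \<times> {..<d}" for p q
  proof -
    obtain n t n' t' where pq: "p = (n, t)" "q = (n', t')" "t < d" "t' < d" using mem by auto
    have "contract {..<d} (tensor_entry d \<Psi>) (teleport_kernel d (bell_measurement d)) p q
        = (\<Sum>s<d. \<Sum>s'<d. if s' = t' then if s = t then tensor_entry d \<Psi> p q else 0 else 0)"
      unfolding pq(1,2) contract_apply
      using assms pq(3,4) by (intro sum.cong refl) (auto simp: teleport_kernel_bell_measurement)
    then show ?thesis using pq(3,4) by simp
  qed
  then show ?thesis
    unfolding payoff_teleport by (intro arg_cong[where f = Re] sum.cong refl) simp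
qed

section \<open>From better payoffs to a channel\<close>

lemma better_imp_kernel:
  assumes \<Phi>: "psd_op (dN * dS) \<Phi>" and \<Psi>: "psd_op (dN * dT) \<Psi>" and "dT > 0"
    and better: "better dN dS dT \<Phi> \<Psi>"
  shows "\<exists>K. channel_kernel {..<dS} {..<dT} K \<and>
      (\<forall>p\<in>{..<dN} \<times> {..<dT}. \<forall>q\<in>{..<dN} \<times> {..<dT}.
        tensor_entry dT \<Psi> p q = contract {..<dS} (tensor_entry dS \<Phi>) K p q)"
proof -
  let ?I = "{..<dN} \<times> {..<dT}" and ?Z = "tensor_entry dT \<Psi>"
  let ?C = "contract {..<dS} (tensor_entry dS \<Phi>)"
  obtain K where K: "channel_kernel {..<dS} {..<dT} K" and
    proj: "\<And>K'. channel_kernel {..<dS} {..<dT} K' \<Longrightarrow>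
      Re (\<Sum>p\<in>?I. \<Sum>q\<in>?I. cnj (?Z p q - ?C K p q) * (?C K' p q - ?C K p q)) \<le> 0"
    using contract_projection[where S = "{..<dS}" and T = "{..<dT}" and N = "{..<dN}" and Z = ?Z
        and A = "tensor_entry dS \<Phi>"] \<open>dT > 0\<close>
    by blast
  define G where "G = (\<lambda>p q. ?Z p q - ?C K p q)"
  have CK: "psd_on ?I (?C K)"
    using \<Phi> K by (intro psd_on_contract) (auto simp: psd_op_tensor_iff channel_kernel_def)
  have Z: "psd_on ?I ?Z" using \<Psi> by (simp add: psd_op_tensor_iff)
  have herm: "G q p = cnj (G p q)" if "p \<in> ?I" "q \<in> ?I" for p q
  proof -
    have "?C K q p = cnj (?C K p q)" "?Z q p = cnj (?Z p q)"
      by (rule psd_on_hermitian[OF _ CK that], simp) (rule psd_on_hermitian[OF _ Z that], simp)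
    then show ?thesis unfolding G_def complex_cnj_diff by (simp only:)
  qed
  \<comment> \<open>The real inner product with \<open>G\<close>, as the projection provides it;
    since \<open>G\<close> is Hermitian it agrees with the trace form in which payoffs
    appear.\<close>
  define pairing where "pairing = (\<lambda>X. Re (\<Sum>p\<in>?I. \<Sum>q\<in>?I. cnj (G p q) * X p q))"
  have pairing: "Re (\<Sum>p\<in>?I. \<Sum>q\<in>?I. G q p * X p q) = pairing X" for X
    unfolding pairing_def by (intro arg_cong[where f = Re] sum.cong refl) (metis herm)
  have pairing_diff: "pairing (\<lambda>p q. X p q - Y p q) = pairing X - pairing Y" for X Y
    by (simp only: pairing_def right_diff_distrib sum_subtractf minus_complex.simps)
  define k where "k = dT * dT"
  define M where "M = teleport_payoff dN dT G"
  define \<rho> where "\<rho> = entangled_state dT"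
  have hermM: "hermitian_op (dN * dT) (M i)" for i
    unfolding M_def by (rule hermitian_op_teleport_payoff) (rule herm)
  have k: "k \<ge> 1" using \<open>dT > 0\<close> by (simp add: k_def Suc_le_eq)
  \<comment> \<open>The Bell measurement attains the left side with \<open>\<Psi>\<close>, while
    every strategy with \<open>\<Phi>\<close> acts as a channel and stays below the nearest
    point.\<close>
  have "pairing ?Z \<le> opt_payoff dN dT dT dT \<Psi> \<rho> k M"
    unfolding opt_payoff_def
  proof (rule cSup_upper[OF _ bdd_above_payoff])
    show "pairing ?Z \<in> {payoff dN dT dT dT \<Psi> \<rho> k M D | D. is_povm (dT * dT) k D}"
      using payoff_bell_measurement[OF \<open>dT > 0\<close>, of dN \<Psi> G] is_povm_bell_measurement[OF \<open>dT > 0\<close>]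
      unfolding k_def M_def \<rho>_def pairing by (metis (mono_tags, lifting) mem_Collect_eq)
  qed
  also have "\<dots> \<le> opt_payoff dN dS dT dT \<Phi> \<rho> k M"
    using better density_op_entangled_state[OF \<open>dT > 0\<close>] hermM k
    unfolding better_def \<rho>_def by blast
  also have "\<dots> \<le> pairing (?C K)"
    unfolding opt_payoff_def
  proof (rule cSup_least)
    show "{payoff dN dS dT dT \<Phi> \<rho> k M D | D. is_povm (dS * dT) k D} \<noteq> {}"
      using povm_exists[OF k, of "dS * dT"] by blast
    fix x assume "x \<in> {payoff dN dS dT dT \<Phi> \<rho> k M D | D. is_povm (dS * dT) k D}"
    then obtain D where D: "is_povm (dS * dT) (dT * dT) D" and x: "x = payoff dN dS dT dT \<Phi> \<rho> k M D"
      by (auto simp: k_def)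
    have "x = pairing (?C (teleport_kernel dT D))"
      unfolding x k_def M_def \<rho>_def payoff_teleport pairing ..
    moreover have "pairing (\<lambda>p q. ?C (teleport_kernel dT D) p q - ?C K p q) \<le> 0"
      using proj[OF channel_kernel_teleport[OF \<open>dT > 0\<close> D]] by (simp add: pairing_def G_def)
    ultimately show "x \<le> pairing (?C K)" by (simp add: pairing_diff)
  qed
  finally have "pairing G \<le> 0" unfolding G_def by (simp add: pairing_diff)
  \<comment> \<open>The nonpositive quantity is the squared norm of \<open>G\<close>, so
    \<open>\<Psi>\<close> coincides with its nearest point.\<close>
  moreover have "pairing G = (\<Sum>p\<in>?I. \<Sum>q\<in>?I. (cmod (G p q))\<^sup>2)"
    unfolding pairing_def cmod_power2 by (simp add: power2_eq_square)
  ultimately have zero: "(\<Sum>p\<in>?I. \<Sum>q\<in>?I. (cmod (G p q))\<^sup>2) = 0"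
    by (simp add: antisym sum_nonneg)
  have "G p q = 0" if "p \<in> ?I" "q \<in> ?I" for p q
  proof -
    have "(\<Sum>q\<in>?I. (cmod (G p q))\<^sup>2) = 0"
      using zero that(1) by (subst (asm) sum_nonneg_eq_0_iff) (auto intro: sum_nonneg)
    then have "(cmod (G p q))\<^sup>2 = 0"
      using that(2) by (subst (asm) sum_nonneg_eq_0_iff) auto
    then show ?thesis by simp
  qed
  with K show ?thesis by (intro exI[of _ K]) (auto simp: G_def)
qed

theorem theorem2:
  fixes dN dS dT :: nat and \<Phi> \<Psi> :: "complex mat"
  assumes "density_op (dN * dS) \<Phi>"
    and "density_op (dN * dT) \<Psi>"
  shows "better dN dS dT \<Phi> \<Psi> \<longleftrightarrow>
    (\<exists>E. cptp dS dT E \<and> \<Psi> = id_tensor dN dS dT E \<Phi>)"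
proof -
  have psd: "psd_op (dN * dS) \<Phi>" "psd_op (dN * dT) \<Psi>" and "mtrace \<Psi> = 1"
    using assms by (auto simp: density_op_def)
  have car: "\<Psi> \<in> carrier_mat (dN * dT) (dN * dT)" using psd(2) by (simp add: psd_op_iff)
  \<comment> \<open>For \<open>dT = 0\<close> the trace of \<open>\<Psi>\<close> would be an empty
    sum.\<close>
  have "dT > 0" using car \<open>mtrace \<Psi> = 1\<close> by (intro gr0I) (auto simp: mtrace_def)
  show ?thesis
    unfolding ex_cptp_iff_ex_kernel[OF car]
  proof
    assume "better dN dS dT \<Phi> \<Psi>"
    then show "\<exists>K. channel_kernel {..<dS} {..<dT} K \<and>
      (\<forall>p\<in>{..<dN} \<times> {..<dT}. \<forall>q\<in>{..<dN} \<times> {..<dT}.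
        tensor_entry dT \<Psi> p q = contract {..<dS} (tensor_entry dS \<Phi>) K p q)"
      by (rule better_imp_kernel[OF psd \<open>dT > 0\<close>])
  next
    assume "\<exists>K. channel_kernel {..<dS} {..<dT} K \<and>
      (\<forall>p\<in>{..<dN} \<times> {..<dT}. \<forall>q\<in>{..<dN} \<times> {..<dT}.
        tensor_entry dT \<Psi> p q = contract {..<dS} (tensor_entry dS \<Phi>) K p q)"
    then show "better dN dS dT \<Phi> \<Psi>"
      by (elim exE conjE) (rule kernel_imp_better, assumption, force)
  qed
qed

end
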